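(* Let $n,N$ be positive integers and let $X_1,\dots,X_N$ be independent isotropic random vectors valued in $\mathbb{R}^n$. Assume that for some $C,\eta>0$ one has, for every $i$ and every orthogonal projection $P$ in $\mathbb{R}^n$, $$\mathbb{P}\{\|PX_i\|_2^2>t\}\le C\,t^{-1-\eta}\quad\text{for all } t>C\,\mathrm{rank}(P).$$ Let $\varepsilon\in(0,1)$ and let $$N\ge C_{\mathrm{main}}\,\varepsilon^{-2-2/\eta}\cdot n,\qquad C_{\mathrm{main}}=512\,(48C)^{2+2/\eta}(6+6/\eta)^{1+4/\eta}.$$ Then $$\mathbb{E}\Big\|\frac1N\sum_{i=1}^N X_iX_i^T-I\Big\|\le\varepsilon.$$
   Context: A random vector $X$ in $\mathbb{R}^n$ is called isotropic if $\mathbb{E}XX^T=I$ (the $n\times n$ identity matrix); it is not required to be centered. The vectors $X_i$ need not be identically distributed. $\|\cdot\|$ denotes the spectral (operator) norm of a matrix and $\|\cdot\|_2$ the Euclidean norm on $\mathbb{R}^n$. *)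

theory Defs
  imports "HOL-Probability.Probability"
begin

definition outer_self :: "real ^ 'n \<Rightarrow> real ^ 'n ^ 'n" where
  "outer_self x = (\<chi> i j. x $ i * x $ j)"

text \<open>
  The matrix identity \<open>E X X\<^sup>T = I\<close> is a Bochner integral in the finite-dimensional
  space of matrices, so \<open>has_bochner_integral\<close> also records integrability of every entry.
  No centering is required.
\<close>

definition isotropic :: "'a measure \<Rightarrow> ('a \<Rightarrow> real ^ 'n) \<Rightarrow> bool" where
  "isotropic M X \<longleftrightarrow>
     X \<in> borel_measurable M \<and> has_bochner_integral M (\<lambda>\<omega>. outer_self (X \<omega>)) (mat 1)"

definition orthogonal_projection :: "real ^ 'n ^ 'n \<Rightarrow> bool" where
  "orthogonal_projection P \<longleftrightarrow> P ** P = P \<and> transpose P = P"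

definition spectral_norm :: "real ^ 'n ^ 'm \<Rightarrow> real" where
  "spectral_norm A = onorm (\<lambda>v. A *v v)"

definition C_main :: "real \<Rightarrow> real \<Rightarrow> real" where
  "C_main C \<eta> = 512 * (48 * C) powr (2 + 2 / \<eta>) * (6 + 6 / \<eta>) powr (1 + 4 / \<eta>)"

end

theory Submission
  imports Defs
begin

text \<open>
  For a level \<open>\<phi>\<close>, the soft edge \<open>\<mu>(A)\<close> of a symmetric matrix is the least \<open>u > \<lambda>\<^sub>m\<^sub>a\<^sub>x(A)\<close> with
  \<open>tr (u - A)\<^sup>-\<^sup>1 \<le> \<phi>\<close> (Batson, Spielman and Srivastava; Srivastava and Vershynin). It dominates
  \<open>\<lambda>\<^sub>m\<^sub>a\<^sub>x\<close>, is at most \<open>n / \<phi>\<close> at \<open>0\<close>, and moves by about \<open>1\<close> on average when \<open>X X\<^sup>T\<close> is added, for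
  isotropic \<open>X\<close>; applied to \<open>-A\<close> it controls \<open>\<lambda>\<^sub>m\<^sub>i\<^sub>n\<close> in the same way. By the Sherman--Morrison formula
  the increment is governed by quadratic forms \<open>X\<^sup>T B X\<close> with \<open>B \<ge> 0\<close>. Such a \<open>B\<close> is a combination
  \<open>\<Sum> c\<^sub>F P\<^sub>F\<close> of orthogonal projections with \<open>c\<^sub>F \<ge> 0\<close>, \<open>\<Sum> c\<^sub>F = \<parallel>B\<parallel>\<close> and \<open>\<Sum> c\<^sub>F rank P\<^sub>F = tr B\<close>, so the
  hypothesis on projections bounds the mean excess of \<open>X\<^sup>T B X\<close> over a multiple of \<open>tr B\<close> plus
  \<open>h \<parallel>B\<parallel>\<close>. Averaging over the \<open>N\<close> steps bounds both soft edges; since \<open>\<lambda>\<^sub>m\<^sub>a\<^sub>x - 1\<close> or \<open>1 - \<lambda>\<^sub>m\<^sub>i\<^sub>n\<close> may be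
  negative, their maximum is bounded by their sum plus the deviation of one fixed marginal, which
  is small by the weak law of large numbers.
\<close>

subsection \<open>Spectral theorem and functional calculus\<close>

text \<open>The first-order condition at a maximum: near \<open>t = 0\<close> a nonzero linear term
  would outweigh the quadratic one.\<close>

lemma quadratic_nonpos_imp_zero:
  fixes b c :: real
  assumes "\<And>t. t * b + t\<^sup>2 * c \<le> 0"
  shows "b = 0"
proof (rule ccontr)
  assume b: "b \<noteq> 0"
  have pos: "\<bar>c\<bar> + 1 > 0" by simp
  \<comment> \<open>With this step length the value at \<open>s\<close> is at least
    \<open>s\<^sup>2\<close>, hence positive.\<close>
  define s where "s = b / (\<bar>c\<bar> + 1)"
  have bs: "b = s * (\<bar>c\<bar> + 1)" and "s \<noteq> 0" using b pos by (auto simp: s_def)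
  have "s * b + s\<^sup>2 * c = s\<^sup>2 * (\<bar>c\<bar> + 1 + c)"
    by (simp add: bs power2_eq_square algebra_simps)
  moreover have "s\<^sup>2 * (\<bar>c\<bar> + 1 + c) > 0"
    using \<open>s \<noteq> 0\<close> by (intro mult_pos_pos) auto
  moreover have "s * b + s\<^sup>2 * c \<le> 0" using assms by blast
  ultimately show False by linarith
qed

lemma symmetric_matrix_inner:
  fixes A :: "real^'n^'n"
  assumes "transpose A = A"
  shows "x \<bullet> (A *v y) = (A *v x) \<bullet> y"
  by (metis assms dot_lmul_matrix transpose_matrix_vector)

text \<open>A maximiser of the Rayleigh quotient on the unit sphere of \<open>W\<close> is an
  eigenvector. Varying it along the residual \<open>z\<close>, which lies in \<open>W\<close> by
  invariance, gives the first-order coefficient \<open>2 * (z \<bullet> z)\<close>, and this must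
  vanish.\<close>

lemma eigenvector_in_invariant_subspace:
  fixes A :: "real^'n^'n"
  assumes sym: "transpose A = A" and W: "subspace W" and ne: "W \<noteq> {0}"
    and inv: "\<And>x. x \<in> W \<Longrightarrow> A *v x \<in> W"
  obtains y c where "y \<in> W" "norm y = 1" "A *v y = c *\<^sub>R y"
proof -
  obtain w where w: "w \<in> W" "w \<noteq> 0" using ne W subspace_0 by blast
  let ?S = "sphere 0 1 \<inter> W"
  have "compact ?S"
    using W by (intro compact_Int_closed) (auto intro: closed_subspace)
  moreover have "(1 / norm w) *\<^sub>R w \<in> ?S"
    using w W by (auto simp: subspace_scale)
  moreover have "continuous_on ?S (\<lambda>y. y \<bullet> (A *v y))"
    by (intro continuous_intros linear_continuous_on matrix_vector_mul_bounded_linear)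
  ultimately obtain y where y: "y \<in> ?S"
    and ymax: "\<And>z. z \<in> ?S \<Longrightarrow> z \<bullet> (A *v z) \<le> y \<bullet> (A *v y)"
    using continuous_attains_sup[of ?S "\<lambda>y. y \<bullet> (A *v y)"] by blast
  define m where "m = y \<bullet> (A *v y)"
  have le: "z \<bullet> (A *v z) \<le> m * (z \<bullet> z)" if "z \<in> W" for z
  proof (cases "z = 0")
    case False
    have "(1 / norm z) *\<^sub>R z \<in> ?S" using False that W by (auto simp: subspace_scale)
    from ymax[OF this] have "(z \<bullet> (A *v z)) / (norm z)\<^sup>2 \<le> m"
      by (simp add: m_def matrix_vector_mult_scaleR power2_eq_square field_simps)
    then show ?thesis using False
      by (simp add: divide_le_eq power2_norm_eq_inner)
  qed simp
  define z where "z = A *v y - m *\<^sub>R y"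
  have yW: "y \<in> W" and ny: "norm y = 1" using y by auto
  have zW: "z \<in> W" unfolding z_def using yW W inv
    by (simp add: subspace_diff subspace_scale)
  have yy: "y \<bullet> y = 1" using ny by (simp add: dot_square_norm)
  have "z \<bullet> z = 0"
  proof -
    have "t * (2 * (z \<bullet> z)) + t\<^sup>2 * (z \<bullet> (A *v z) - m * (z \<bullet> z)) \<le> 0" for t
    proof -
      have "y + t *\<^sub>R z \<in> W" using yW zW W by (simp add: subspace_add subspace_scale)
      from le[OF this]
      have "m + t * (y \<bullet> (A *v z)) + t * (z \<bullet> (A *v y)) + t\<^sup>2 * (z \<bullet> (A *v z))
          \<le> m * (1 + 2 * t * (y \<bullet> z) + t\<^sup>2 * (z \<bullet> z))"
        by (simp add: algebra_simps inner_add_left inner_add_right m_def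
              matrix_vector_right_distrib yy inner_commute power2_eq_square)
      moreover have "y \<bullet> (A *v z) = z \<bullet> (A *v y)"
        using symmetric_matrix_inner[OF sym, of y z] by (simp add: inner_commute)
      moreover have "z \<bullet> (A *v y) = z \<bullet> z + m * (y \<bullet> z)"
        by (simp add: z_def inner_diff_left inner_diff_right inner_commute algebra_simps)
      ultimately show ?thesis by (simp add: algebra_simps)
    qed
    then show ?thesis using quadratic_nonpos_imp_zero by fastforce
  qed
  then have "A *v y = m *\<^sub>R y" by (simp add: z_def)
  with yW ny show ?thesis using that by blast
qed

text \<open>Indexing by the coordinate type makes every such family a basis of the whole
  space.\<close>

definition orthonormal_family :: "('n \<Rightarrow> real^'n) \<Rightarrow> bool" where
  "orthonormal_family e \<longleftrightarrow> (\<forall>i j. e i \<bullet> e j = (if i = j then 1 else 0))"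

text \<open>Induction on \<open>k\<close>: the vectors orthogonal to the eigenvectors found so far
  form a subspace \<open>W\<close>, invariant by symmetry and nonzero as long as their number is
  below the dimension.\<close>

lemma symmetric_matrix_eigenset:
  fixes A :: "real^'n^'n"
  assumes sym: "transpose A = A" and "k \<le> CARD('n)"
  shows "\<exists>S. finite S \<and> card S = k \<and> (\<forall>x\<in>S. norm x = 1 \<and> (\<exists>c. A *v x = c *\<^sub>R x))
           \<and> pairwise orthogonal S"
  using assms(2)
proof (induction k)
  case 0
  show ?case by (intro exI[of _ "{}"]) (auto simp: pairwise_def)
next
  case (Suc k)
  then obtain S where S: "finite S" "card S = k"
    "\<And>x. x \<in> S \<Longrightarrow> norm x = 1 \<and> (\<exists>c. A *v x = c *\<^sub>R x)" "pairwise orthogonal S" by auto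
  define W where "W = {y. \<forall>x\<in>S. orthogonal x y}"
  have W: "subspace W"
    unfolding W_def by (auto simp: subspace_def orthogonal_def inner_add_right)
  have "dim (span S) < DIM(real^'n)"
    using dim_le_card'[OF S(1)] Suc.prems S(2) by simp
  then obtain w where "w \<noteq> 0" "\<And>y. y \<in> span (span S) \<Longrightarrow> orthogonal w y"
    using orthogonal_to_subspace_exists by (metis dim_span)
  then have "w \<in> W" unfolding W_def by (simp add: orthogonal_commute span_base)
  then have ne: "W \<noteq> {0}" using \<open>w \<noteq> 0\<close> by blast
  have inv: "A *v y \<in> W" if "y \<in> W" for y
    unfolding W_def
  proof safe
    fix x assume x: "x \<in> S"
    then obtain c where "A *v x = c *\<^sub>R x" using S(3) by blast
    then show "orthogonal x (A *v y)"
      using that x symmetric_matrix_inner[OF sym, of x y]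
      by (simp add: W_def orthogonal_def)
  qed
  obtain y c where y: "y \<in> W" "norm y = 1" "A *v y = c *\<^sub>R y"
    using eigenvector_in_invariant_subspace[OF sym W ne inv] by blast
  have "y \<notin> S" using y(1,2) by (auto simp: W_def orthogonal_def)
  then have "card (insert y S) = Suc k" using S by simp
  moreover have "pairwise orthogonal (insert y S)"
    using S(4) y(1) by (auto simp: pairwise_insert W_def orthogonal_commute)
  ultimately show ?case using S y
    by (intro exI[of _ "insert y S"]) auto
qed

theorem symmetric_matrix_eigenbasis:
  fixes A :: "real^'n^'n"
  assumes "transpose A = A"
  obtains e l where "orthonormal_family e" "\<And>i. A *v e i = l i *\<^sub>R e i"
proof -
  obtain S where S: "finite S" "card S = CARD('n)"
    "\<And>x. x \<in> S \<Longrightarrow> norm x = 1 \<and> (\<exists>c. A *v x = c *\<^sub>R x)" "pairwise orthogonal S"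
    using symmetric_matrix_eigenset[OF assms order_refl] by blast
  obtain e where e: "bij_betw e (UNIV :: 'n set) S"
    using finite_same_card_bij[of "UNIV :: 'n set" S] S by auto
  have eS: "e i \<in> S" for i using e by (auto simp: bij_betw_def)
  have "e i \<noteq> e j" if "i \<noteq> j" for i j using e that by (auto simp: bij_betw_def inj_def)
  then have "orthonormal_family e"
    using S(3,4) eS by (auto simp: orthonormal_family_def pairwise_def orthogonal_def dot_square_norm)
  moreover define l where "l i = (SOME c. A *v e i = c *\<^sub>R e i)" for i
  have "A *v e i = l i *\<^sub>R e i" for i
    using S(3)[OF eS[of i]] unfolding l_def by (metis (mono_tags, lifting) someI_ex)
  ultimately show ?thesis using that by blast
qed

section \<open>Outer products, traces and diagonal matrices in an orthonormal basis\<close>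

lemma outer_self_mult_vec: "outer_self x *v y = (x \<bullet> y) *\<^sub>R x"
  by (simp add: vec_eq_iff outer_self_def matrix_vector_mult_def inner_vec_def sum_distrib_right)
    (simp add: mult.commute mult.left_commute)

lemma transpose_outer_self [simp]: "transpose (outer_self x) = outer_self x"
  by (vector outer_self_def transpose_def)

lemma inner_outer_self: "y \<bullet> (outer_self x *v y) = (x \<bullet> y)\<^sup>2"
  by (simp add: outer_self_mult_vec power2_eq_square inner_commute)

lemma trace_outer_self: "trace (outer_self x) = x \<bullet> x"
  by (simp add: trace_def outer_self_def inner_vec_def)

lemma trace_scaleR: "trace (c *\<^sub>R (A::real^'n^'n)) = c * trace A"
  by (simp add: trace_def sum_distrib_left)

lemma trace_sum: "trace (\<Sum>i\<in>I. f i :: real^'n^'n) = (\<Sum>i\<in>I. trace (f i))"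
  unfolding trace_def by (simp add: sum.swap[of _ I])

lemma matrix_sum_mult_vec: "(\<Sum>i\<in>I. f i :: real^'n^'m) *v x = (\<Sum>i\<in>I. f i *v x)"
  by (induction I rule: infinite_finite_induct) (simp_all add: matrix_vector_mult_add_rdistrib)

lemma transpose_sum: "transpose (\<Sum>i\<in>I. f i :: real^'n^'m) = (\<Sum>i\<in>I. transpose (f i))"
  by (induction I rule: infinite_finite_induct)
    (simp_all add: transpose_def vec_eq_iff)

lemma transpose_add: "transpose (A + B :: real^'n^'m) = transpose A + transpose B"
  by (vector transpose_def)

lemma transpose_diff: "transpose (A - B :: real^'n^'m) = transpose A - transpose B"
  by (vector transpose_def)

lemma transpose_uminus: "transpose (- A :: real^'n^'m) = - transpose A"
  by (vector transpose_def)

lemma scaleR_mat_mult_vec: "(c *\<^sub>R mat 1 :: real^'n^'n) *v x = c *\<^sub>R x"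
  by (simp flip: scaleR_matrix_vector_assoc)

text \<open>With the \<open>e i\<close> as rows, \<open>Q ** transpose Q = mat 1\<close>; for a
  square matrix the reversed product is the identity too, and that product is the expansion.\<close>

lemma orthonormal_expansion:
  fixes e :: "'n::finite \<Rightarrow> real^'n"
  assumes "orthonormal_family e"
  shows "(\<Sum>i\<in>UNIV. (e i \<bullet> x) *\<^sub>R e i) = x"
proof -
  define Q :: "real^'n^'n" where "Q = (\<chi> i. e i)"
  have "Q ** transpose Q = mat 1"
    using assms by (simp add: Q_def orthonormal_family_def matrix_matrix_mult_def transpose_def
        mat_def vec_eq_iff inner_vec_def)
  then have "transpose Q ** Q = mat 1" by (simp add: matrix_left_right_inverse)
  then have "transpose Q *v (Q *v x) = x" by (simp add: matrix_vector_mul_assoc)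
  moreover have "transpose Q *v (Q *v x) = (\<Sum>i\<in>UNIV. (e i \<bullet> x) *\<^sub>R e i)"
    by (simp add: Q_def vec_eq_iff matrix_vector_mult_def transpose_def inner_vec_def mult_ac)
  ultimately show ?thesis by simp
qed

lemma orthonormal_parseval:
  fixes e :: "'n::finite \<Rightarrow> real^'n"
  assumes "orthonormal_family e"
  shows "x \<bullet> y = (\<Sum>i\<in>UNIV. (e i \<bullet> x) * (e i \<bullet> y))"
proof -
  have "x \<bullet> y = (\<Sum>i\<in>UNIV. (e i \<bullet> x) *\<^sub>R e i) \<bullet> y"
    by (simp add: orthonormal_expansion[OF assms])
  then show ?thesis by (simp add: inner_sum_left)
qed

text \<open>The functional calculus: if a symmetric matrix is \<open>diag_in e l\<close>, replacing
  each \<open>l i\<close> by \<open>f (l i)\<close> applies \<open>f\<close> to the matrix.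
  Resolvents in particular keep this form.\<close>

definition diag_in :: "('n::finite \<Rightarrow> real^'n) \<Rightarrow> ('n \<Rightarrow> real) \<Rightarrow> real^'n^'n" where
  "diag_in e g = (\<Sum>i\<in>UNIV. g i *\<^sub>R outer_self (e i))"

lemma diag_in_mult_vec: "diag_in e g *v x = (\<Sum>i\<in>UNIV. (g i * (e i \<bullet> x)) *\<^sub>R e i)"
  by (simp add: diag_in_def matrix_sum_mult_vec outer_self_mult_vec flip: scaleR_matrix_vector_assoc)

lemma transpose_diag_in [simp]: "transpose (diag_in e g) = diag_in e g"
  by (simp add: diag_in_def transpose_sum transpose_scalar)

lemma inner_diag_in:
  "x \<bullet> (diag_in e g *v y) = (\<Sum>i\<in>UNIV. g i * (e i \<bullet> x) * (e i \<bullet> y))"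
  by (simp add: diag_in_mult_vec inner_sum_right mult_ac inner_commute)

lemma orthonormal_inner_diag_in:
  assumes "orthonormal_family e"
  shows "e i \<bullet> (diag_in e g *v x) = g i * (e i \<bullet> x)"
proof -
  have "e i \<bullet> (diag_in e g *v x) = (\<Sum>j\<in>UNIV. if j = i then g j * (e j \<bullet> x) else 0)"
    unfolding inner_diag_in
    using assms by (intro sum.cong) (auto simp: orthonormal_family_def)
  then show ?thesis by simp
qed

lemma diag_in_mult:
  assumes "orthonormal_family e"
  shows "diag_in e g ** diag_in e h = diag_in e (\<lambda>i. g i * h i)"
proof -
  have "(diag_in e g ** diag_in e h) *v x = diag_in e (\<lambda>i. g i * h i) *v x" for x
    by (simp flip: matrix_vector_mul_assoc)
      (simp add: diag_in_mult_vec[of e g] diag_in_mult_vec[of e "\<lambda>i. g i * h i"]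
        orthonormal_inner_diag_in[OF assms] mult_ac)
  then show ?thesis by (simp add: matrix_eq)
qed

lemma diag_in_const:
  assumes "orthonormal_family e"
  shows "diag_in e (\<lambda>_. c) = c *\<^sub>R mat 1"
proof -
  have "diag_in e (\<lambda>_. c) *v x = c *\<^sub>R x" for x
    using orthonormal_expansion[OF assms, of x]
    by (simp add: diag_in_mult_vec flip: scaleR_sum_right scaleR_scaleR)
  then show ?thesis by (simp add: matrix_eq scaleR_mat_mult_vec)
qed

lemma diag_in_diff: "diag_in e g - diag_in e h = diag_in e (\<lambda>i. g i - h i)"
  by (simp add: diag_in_def sum_subtractf algebra_simps)

lemma trace_diag_in:
  assumes "orthonormal_family e"
  shows "trace (diag_in e g) = sum g UNIV"
  using assms by (simp add: diag_in_def trace_sum trace_scaleR trace_outer_self orthonormal_family_def)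

lemma matrix_inv_diag_in:
  assumes "orthonormal_family e" "\<And>i. d i \<noteq> 0"
  shows "diag_in e (\<lambda>i. 1 / d i) ** diag_in e d = mat 1"
  using assms by (simp add: diag_in_mult diag_in_const)

text \<open>The form of the spectral theorem used from here on; the two matrices agree on any vector
  once it is expanded in eigenvectors.\<close>

lemma symmetric_eq_diag_in:
  fixes A :: "real^'n^'n"
  assumes "transpose A = A"
  obtains e l where "orthonormal_family e" "A = diag_in e l"
proof -
  obtain e l where e: "orthonormal_family e" "\<And>i. A *v e i = l i *\<^sub>R e i"
    using symmetric_matrix_eigenbasis[OF assms] by blast
  have "A *v x = diag_in e l *v x" for x
  proof -
    have "A *v x = A *v (\<Sum>i\<in>UNIV. (e i \<bullet> x) *\<^sub>R e i)"
      by (simp add: orthonormal_expansion[OF e(1)])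
    also have "\<dots> = (\<Sum>i\<in>UNIV. (e i \<bullet> x) *\<^sub>R (A *v e i))"
      by (simp add: linear_sum[OF matrix_vector_mul_linear] matrix_vector_mult_scaleR o_def)
    finally show ?thesis by (simp add: e(2) diag_in_mult_vec mult_ac)
  qed
  then have "A = diag_in e l" by (simp add: matrix_eq)
  with e(1) show ?thesis using that by blast
qed

subsection \<open>The soft spectral edge\<close>

definition posdef :: "real^'n^'n \<Rightarrow> bool" where
  "posdef M \<longleftrightarrow> transpose M = M \<and> (\<forall>y. y \<noteq> 0 \<longrightarrow> 0 < y \<bullet> (M *v y))"

lemma invertible_mult_matrix_inv:
  assumes "invertible M"
  shows "M ** matrix_inv M = mat 1"
  using assms unfolding invertible_def matrix_inv_def by (metis (mono_tags, lifting) someI_ex)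

lemma posdef_inverse:
  fixes M :: "real^'n^'n"
  assumes "posdef M"
  shows "M ** matrix_inv M = mat 1"
proof -
  have "inj ((*v) M)"
  proof (rule injI)
    fix x y assume "M *v x = M *v y"
    then have "(x - y) \<bullet> (M *v (x - y)) = 0" by (simp add: matrix_vector_mult_diff_distrib)
    then show "x = y" using assms unfolding posdef_def by (metis less_irrefl right_minus_eq)
  qed
  then have "invertible M"
    using matrix_left_invertible_injective invertible_left_inverse by blast
  then show ?thesis by (rule invertible_mult_matrix_inv)
qed

lemma matrix_inv_eqI:
  fixes M R :: "real^'n^'n"
  assumes "R ** M = mat 1"
  shows "matrix_inv M = R"
proof -
  have "M ** R = mat 1" using assms by (simp add: matrix_left_right_inverse)
  with assms have "invertible M" unfolding invertible_def by blast
  then have "M ** matrix_inv M = mat 1" by (rule invertible_mult_matrix_inv)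
  then have "R ** (M ** matrix_inv M) = R" by simp
  then show ?thesis by (simp add: matrix_mul_assoc assms)
qed

lemma trace_eq_sum_inner: "trace (M::real^'n^'n) = (\<Sum>i\<in>UNIV. axis i 1 \<bullet> (M *v axis i 1))"
  by (simp add: trace_def inner_axis' matrix_vector_mult_basis column_def)

text \<open>Inversion reverses the Loewner order. With \<open>y\<close> and \<open>z\<close> the two
  inverses applied to \<open>x\<close>, expanding
  \<open>0 \<le> (y - z) \<bullet> (M *v (y - z))\<close> gives \<open>2 * (x \<bullet> y) \<le> y
  \<bullet> (M *v y) + x \<bullet> z\<close>, and \<open>le\<close> bounds
  \<open>y \<bullet> (M *v y)\<close> by \<open>x \<bullet> y\<close>. Summing over the coordinate
  basis yields traces.\<close>

lemma trace_matrix_inv_antimono: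
  fixes M M' :: "real^'n^'n"
  assumes M: "posdef M" and M': "transpose M' = M'"
    and le: "\<And>y. y \<bullet> (M *v y) \<le> y \<bullet> (M' *v y)"
  shows "posdef M'" "trace (matrix_inv M') \<le> trace (matrix_inv M)"
proof -
  show pd: "posdef M'"
    using M M' le unfolding posdef_def by (meson less_le_trans)
  have "x \<bullet> (matrix_inv M' *v x) \<le> x \<bullet> (matrix_inv M *v x)" for x
  proof -
    define y z where "y = matrix_inv M' *v x" and "z = matrix_inv M *v x"
    have My: "M' *v y = x" and Mz: "M *v z = x"
      using posdef_inverse[OF pd] posdef_inverse[OF M]
      by (simp_all add: y_def z_def matrix_vector_mul_assoc)
    have "0 \<le> (y - z) \<bullet> (M *v (y - z))"
      using M unfolding posdef_def by (cases "y - z = 0") (auto simp: less_imp_le)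
    also have "\<dots> = y \<bullet> (M *v y) - y \<bullet> x - z \<bullet> (M *v y) + z \<bullet> x"
      by (simp add: matrix_vector_mult_diff_distrib Mz inner_diff_left inner_diff_right)
    also have "z \<bullet> (M *v y) = x \<bullet> y"
      using M Mz symmetric_matrix_inner[of M z y] by (simp add: posdef_def)
    finally have "2 * (x \<bullet> y) \<le> y \<bullet> (M *v y) + x \<bullet> z" by (simp add: inner_commute)
    also have "y \<bullet> (M *v y) \<le> x \<bullet> y" using le[of y] My by (simp add: inner_commute)
    finally show ?thesis by (simp add: y_def z_def)
  qed
  then show "trace (matrix_inv M') \<le> trace (matrix_inv M)"
    unfolding trace_eq_sum_inner by (intro sum_mono)
qed

text \<open>Positive definiteness says that \<open>u\<close> lies above the largest eigenvalue.
  Keeping all admissible levels, and not only the root of the trace equation, lets an upper bound on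
  the edge be proved by exhibiting one member.\<close>

definition edge_set :: "real \<Rightarrow> real^'n^'n \<Rightarrow> real set" where
  "edge_set \<phi> A = {u. posdef (u *\<^sub>R mat 1 - A) \<and> trace (matrix_inv (u *\<^sub>R mat 1 - A)) \<le> \<phi>}"

definition soft_edge :: "real \<Rightarrow> real^'n^'n \<Rightarrow> real" where
  "soft_edge \<phi> A = Inf (edge_set \<phi> A)"

text \<open>By \<open>le\<close>, the matrix \<open>(u + s) *\<^sub>R mat 1 - A'\<close> dominates
  \<open>u *\<^sub>R mat 1 - A\<close>, and traces of inverses are antitone.\<close>

lemma edge_set_shift:
  fixes A A' :: "real^'n^'n"
  assumes "u \<in> edge_set \<phi> A" "transpose A' = A'"
    and le: "\<And>y. y \<bullet> (A' *v y) \<le> y \<bullet> (A *v y) + s * (y \<bullet> y)"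
  shows "u + s \<in> edge_set \<phi> A'"
proof -
  have pd: "posdef (u *\<^sub>R mat 1 - A)" and tr: "trace (matrix_inv (u *\<^sub>R mat 1 - A)) \<le> \<phi>"
    using assms by (auto simp: edge_set_def)
  have sym: "transpose ((u + s) *\<^sub>R mat 1 - A') = (u + s) *\<^sub>R mat 1 - A'"
    using assms(2) by (simp add: transpose_diff transpose_scalar)
  have "y \<bullet> ((u *\<^sub>R mat 1 - A) *v y) \<le> y \<bullet> (((u + s) *\<^sub>R mat 1 - A') *v y)" for y
    using le[of y]
    by (simp add: matrix_vector_mult_diff_rdistrib scaleR_mat_mult_vec inner_diff_right algebra_simps)
  from trace_matrix_inv_antimono[OF pd sym this] tr show ?thesis
    by (simp add: edge_set_def)
qed

text \<open>At the zero matrix the trace is the dimension divided by the level, so the bound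
  \<open>\<phi>\<close> is met with equality here. This is the initial cost of the summation, later
  divided by \<open>N\<close>.\<close>

lemma edge_set_zero:
  assumes "\<phi> > 0"
  shows "real CARD('n) / \<phi> \<in> edge_set \<phi> (0 :: real^'n^'n)"
proof -
  define c where "c = real CARD('n) / \<phi>"
  have c: "c > 0" using assms by (simp add: c_def)
  have "posdef (c *\<^sub>R mat 1 :: real^'n^'n)"
    using c by (simp add: posdef_def transpose_scalar scaleR_mat_mult_vec)
  moreover have "matrix_inv (c *\<^sub>R mat 1 :: real^'n^'n) = (1 / c) *\<^sub>R mat 1"
    using c by (intro matrix_inv_eqI) (simp add: scalar_matrix_assoc[symmetric] flip: matrix_scalar_ac)
  moreover have "trace ((1 / c) *\<^sub>R mat 1 :: real^'n^'n) = \<phi>"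
    using assms by (simp add: trace_scaleR trace_I c_def)
  ultimately show ?thesis by (simp add: edge_set_def c_def)
qed

text \<open>Here \<open>norm A\<close> is the Frobenius norm, so Cauchy--Schwarz in each row
  suffices.\<close>

lemma abs_quadratic_form_le:
  fixes A :: "real^'n^'n"
  shows "\<bar>y \<bullet> (A *v y)\<bar> \<le> norm A * (y \<bullet> y)"
proof -
  have "(norm (A *v y))\<^sup>2 = (\<Sum>i\<in>UNIV. (A $ i \<bullet> y)\<^sup>2)"
    unfolding power2_norm_eq_inner inner_vec_def[of "A *v y"]
    by (simp add: matrix_vector_mul_component power2_eq_square)
  also have "\<dots> \<le> (\<Sum>i\<in>UNIV. (norm (A $ i))\<^sup>2 * (norm y)\<^sup>2)"
    by (intro sum_mono) (metis Cauchy_Schwarz_ineq2 power_mult_distrib abs_ge_zero power2_abs power_mono)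
  also have "\<dots> = (norm A)\<^sup>2 * (norm y)\<^sup>2"
    by (simp add: norm_vec_def L2_set_def sum_nonneg flip: sum_distrib_right)
  finally have "norm (A *v y) \<le> norm A * norm y"
    unfolding power_mult_distrib[symmetric] by (rule power2_le_imp_le) simp
  then have "norm y * norm (A *v y) \<le> norm y * (norm A * norm y)"
    by (intro mult_left_mono) auto
  also have "\<dots> = norm A * (y \<bullet> y)"
    by (simp add: dot_square_norm power2_eq_square)
  finally have "norm y * norm (A *v y) \<le> norm A * (y \<bullet> y)" .
  then show ?thesis using Cauchy_Schwarz_ineq2[of y "A *v y"] by linarith
qed

lemma edge_set_nonempty:
  fixes A :: "real^'n^'n"
  assumes "\<phi> > 0" "transpose A = A"
  shows "edge_set \<phi> A \<noteq> {}"
proof -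
  have "real CARD('n) / \<phi> + norm A \<in> edge_set \<phi> A"
    using edge_set_zero[OF assms(1)] assms(2)
  proof (rule edge_set_shift)
    show "y \<bullet> (A *v y) \<le> y \<bullet> (0 *v y) + norm A * (y \<bullet> y)" for y
      using abs_quadratic_form_le[of y A] by simp
  qed
  then show ?thesis by blast
qed

lemma edge_set_gt_quadratic_form:
  fixes A :: "real^'n^'n"
  assumes "u \<in> edge_set \<phi> A" "norm y = 1"
  shows "y \<bullet> (A *v y) < u"
proof -
  have "y \<noteq> 0" using assms(2) by auto
  then have "0 < y \<bullet> ((u *\<^sub>R mat 1 - A) *v y)" using assms(1) by (simp add: edge_set_def posdef_def)
  then show ?thesis using assms(2)
    by (simp add: matrix_vector_mult_diff_rdistrib scaleR_mat_mult_vec inner_diff_right dot_square_norm)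
qed

lemma bdd_below_edge_set: "bdd_below (edge_set \<phi> (A :: real^'n^'n))"
proof -
  obtain y :: "real^'n" where "norm y = 1" using vector_choose_size[of 1] by auto
  then show ?thesis
    by (intro bdd_belowI[of _ "y \<bullet> (A *v y)"]) (simp add: edge_set_gt_quadratic_form less_imp_le)
qed

lemma soft_edge_le: "u \<in> edge_set \<phi> A \<Longrightarrow> soft_edge \<phi> A \<le> u"
  unfolding soft_edge_def by (rule cInf_lower[OF _ bdd_below_edge_set])

lemma quadratic_form_le_soft_edge:
  fixes A :: "real^'n^'n"
  assumes "\<phi> > 0" "transpose A = A" "norm y = 1"
  shows "y \<bullet> (A *v y) \<le> soft_edge \<phi> A"
  unfolding soft_edge_def
  using assms by (intro cInf_greatest edge_set_nonempty) (auto dest: edge_set_gt_quadratic_form)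

lemma soft_edge_mono_shift:
  fixes A A' :: "real^'n^'n"
  assumes "\<phi> > 0" "transpose A = A" "transpose A' = A'"
    and "\<And>y. y \<bullet> (A' *v y) \<le> y \<bullet> (A *v y) + s * (y \<bullet> y)"
  shows "soft_edge \<phi> A' \<le> soft_edge \<phi> A + s"
proof -
  have "soft_edge \<phi> A' - s \<le> u" if "u \<in> edge_set \<phi> A" for u
    using soft_edge_le[OF edge_set_shift[OF that assms(3,4)]] by simp
  then have "soft_edge \<phi> A' - s \<le> soft_edge \<phi> A"
    unfolding soft_edge_def[of _ A] using edge_set_nonempty[OF assms(1,2)]
    by (intro cInf_greatest) auto
  then show ?thesis by simp
qed

text \<open>Monotonicity under shifts, applied in both directions. Measurability and integrability
  of random edges rest on this bound.\<close>

lemma soft_edge_lipschitz: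
  fixes A A' :: "real^'n^'n"
  assumes "\<phi> > 0" "transpose A = A" "transpose A' = A'"
  shows "\<bar>soft_edge \<phi> A - soft_edge \<phi> A'\<bar> \<le> norm (A - A')"
proof -
  have *: "soft_edge \<phi> A' \<le> soft_edge \<phi> A + norm (A' - A)"
    if "transpose A = A" "transpose A' = A'" for A A' :: "real^'n^'n"
  proof (rule soft_edge_mono_shift[OF assms(1) that])
    show "y \<bullet> (A' *v y) \<le> y \<bullet> (A *v y) + norm (A' - A) * (y \<bullet> y)" for y
      using abs_quadratic_form_le[of y "A' - A"]
      by (simp add: matrix_vector_mult_diff_rdistrib inner_diff_right)
  qed
  show ?thesis using *[of A A'] *[of A' A] assms by (simp add: norm_minus_commute)
qed

section \<open>Admissible levels and rank-one updates in eigencoordinates\<close>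

lemma posdef_diag_in:
  assumes e: "orthonormal_family e" and d: "\<And>i. d i > 0"
  shows "posdef (diag_in e d)"
  unfolding posdef_def
proof safe
  fix y :: "real^'a" assume "y \<noteq> 0"
  then obtain i where "e i \<bullet> y \<noteq> 0"
    using orthonormal_expansion[OF e, of y] by (metis (mono_tags, lifting) scaleR_zero_left sum.neutral)
  then show "0 < y \<bullet> (diag_in e d *v y)"
    unfolding inner_diag_in mult.assoc
    using d by (intro sum_pos2[of _ i]) (auto simp: less_imp_le zero_less_mult_iff linorder_neq_iff)
qed simp

lemma posdef_diag_in_imp_pos:
  assumes e: "orthonormal_family e" and "posdef (diag_in e d)"
  shows "d i > 0"
proof -
  have "e i \<bullet> e i = 1" using e by (simp add: orthonormal_family_def)
  moreover from this have "e i \<noteq> 0" by auto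
  ultimately show ?thesis
    using assms(2) orthonormal_inner_diag_in[OF e, of i d "e i"] unfolding posdef_def by (metis mult.right_neutral)
qed

lemma edge_set_diag_in_iff:
  assumes e: "orthonormal_family e"
  shows "u \<in> edge_set \<phi> (diag_in e l) \<longleftrightarrow> (\<forall>i. l i < u) \<and> (\<Sum>i\<in>UNIV. 1 / (u - l i)) \<le> \<phi>"
proof -
  have eq: "u *\<^sub>R mat 1 - diag_in e l = diag_in e (\<lambda>i. u - l i)"
    by (simp add: diag_in_diff flip: diag_in_const[OF e])
  have inv: "matrix_inv (diag_in e (\<lambda>i. u - l i)) = diag_in e (\<lambda>i. 1 / (u - l i))" if "\<And>i. l i < u"
    using that by (intro matrix_inv_eqI matrix_inv_diag_in[OF e]) (auto simp: less_le)
  show ?thesis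
    unfolding edge_set_def mem_Collect_eq eq
    using posdef_diag_in[OF e, of "\<lambda>i. u - l i"] posdef_diag_in_imp_pos[OF e, of "\<lambda>i. u - l i"] inv
    by (auto simp: trace_diag_in[OF e])
qed

text \<open>This is the Sherman--Morrison formula, read off on the trace of the inverse.\<close>

lemma edge_set_rank_one_update:
  assumes e: "orthonormal_family e" and lt: "\<And>i. l i < v"
    and q: "q = (\<Sum>i\<in>UNIV. (e i \<bullet> x)\<^sup>2 / (v - l i))" and sq: "s * q < 1"
    and tr: "(\<Sum>i\<in>UNIV. 1 / (v - l i)) + s * (\<Sum>i\<in>UNIV. (e i \<bullet> x)\<^sup>2 / (v - l i)\<^sup>2) / (1 - s * q) \<le> \<phi>"
  shows "v \<in> edge_set \<phi> (diag_in e l + s *\<^sub>R outer_self x)"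
proof -
  define d where "d i = v - l i" for i
  have d: "d i > 0" for i using lt by (simp add: d_def)
  then have d0: "d i \<noteq> 0" for i by (metis less_irrefl)
  define D B where "D = diag_in e d" and "B = diag_in e (\<lambda>i. 1 / d i)"
  define M where "M = D - s *\<^sub>R outer_self x"
  have eqM: "v *\<^sub>R mat 1 - (diag_in e l + s *\<^sub>R outer_self x) = M"
    by (simp add: M_def D_def d_def[abs_def] diag_in_diff diff_diff_eq[symmetric] flip: diag_in_const[OF e])
  have BD: "B ** D = mat 1" unfolding B_def D_def by (rule matrix_inv_diag_in[OF e d0])
  then have DB: "D ** B = mat 1" by (simp add: matrix_left_right_inverse)
  have symM: "transpose M = M" by (simp add: M_def D_def transpose_diff transpose_scalar)
  have quadM: "y \<bullet> (M *v y) = y \<bullet> (D *v y) - s * (x \<bullet> y)\<^sup>2" for y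
    by (simp add: M_def matrix_vector_mult_diff_rdistrib inner_diff_right inner_outer_self
        flip: scaleR_matrix_vector_assoc)
  \<comment> \<open>Weighted Cauchy--Schwarz with weights \<open>sqrt (d i)\<close>: the outer
    product of \<open>x\<close> is at most \<open>q\<close> times \<open>D\<close> in the Loewner
    order.\<close>
  have CS: "(x \<bullet> y)\<^sup>2 \<le> q * (y \<bullet> (D *v y))" for y
  proof -
    have "x \<bullet> y = (\<Sum>i\<in>UNIV. ((e i \<bullet> x) / sqrt (d i)) * (sqrt (d i) * (e i \<bullet> y)))"
      unfolding orthonormal_parseval[OF e, of x y] using d0 by (intro sum.cong) auto
    then have "(x \<bullet> y)\<^sup>2 \<le> (\<Sum>i\<in>UNIV. ((e i \<bullet> x) / sqrt (d i))\<^sup>2) * (\<Sum>i\<in>UNIV. (sqrt (d i) * (e i \<bullet> y))\<^sup>2)"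
      by (simp only: Cauchy_Schwarz_ineq_sum)
    also have "(\<Sum>i\<in>UNIV. ((e i \<bullet> x) / sqrt (d i))\<^sup>2) = q"
      unfolding q d_def[symmetric] using d by (intro sum.cong) (auto simp: power_divide less_imp_le)
    also have "(\<Sum>i\<in>UNIV. (sqrt (d i) * (e i \<bullet> y))\<^sup>2) = y \<bullet> (D *v y)"
      unfolding D_def inner_diag_in using d
      by (intro sum.cong) (auto simp: power_mult_distrib less_imp_le power2_eq_square)
    finally show ?thesis .
  qed
  have pdD: "posdef D" unfolding D_def by (rule posdef_diag_in[OF e d])
  have pd: "posdef M"
    unfolding posdef_def
  proof safe
    fix y :: "real^'a" assume "y \<noteq> 0"
    then have Y: "0 < y \<bullet> (D *v y)" using pdD by (simp add: posdef_def)
    have "s * (x \<bullet> y)\<^sup>2 < y \<bullet> (D *v y)"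
    proof (cases "s \<le> 0")
      case True
      then have "s * (x \<bullet> y)\<^sup>2 \<le> 0" by (simp add: mult_nonpos_nonneg)
      then show ?thesis using Y by linarith
    next
      case False
      then have "s * (x \<bullet> y)\<^sup>2 \<le> s * (q * (y \<bullet> (D *v y)))"
        using CS by (intro mult_left_mono) auto
      also have "\<dots> = (s * q) * (y \<bullet> (D *v y))" by simp
      also have "\<dots> < 1 * (y \<bullet> (D *v y))" using sq Y by (rule mult_strict_right_mono)
      finally show ?thesis by simp
    qed
    then show "0 < y \<bullet> (M *v y)" by (simp add: quadM)
  qed (rule symM)
  \<comment> \<open>The inverse of \<open>M\<close> will be \<open>B\<close> plus \<open>c\<close>
    times the outer product of \<open>z\<close>; the identity for \<open>c\<close> cancels the
    rank-one remainder in the verification.\<close>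
  define z c where "z = B *v x" and "c = s / (1 - s * q)"
  have c: "c - s - s * c * q = 0" using sq by (simp add: c_def field_simps)
  have Dz: "D *v z = x" by (simp add: z_def matrix_vector_mul_assoc DB)
  have xz: "x \<bullet> z = q"
    unfolding z_def B_def inner_diag_in q d_def[symmetric] by (simp add: power2_eq_square)
  have "(M ** (B + c *\<^sub>R outer_self z)) *v y = mat 1 *v y" for y
  proof -
    have xBy: "x \<bullet> (B *v y) = z \<bullet> y"
      unfolding z_def by (rule symmetric_matrix_inner) (simp add: B_def)
    have DBy: "D *v (B *v y) = y" by (simp add: matrix_vector_mul_assoc DB)
    have "(M ** (B + c *\<^sub>R outer_self z)) *v y = M *v (B *v y + (c * (z \<bullet> y)) *\<^sub>R z)"
      by (simp add: matrix_vector_mult_add_rdistrib outer_self_mult_vec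
          flip: matrix_vector_mul_assoc scaleR_matrix_vector_assoc)
    also have "\<dots> = y + ((z \<bullet> y) * (c - s - s * c * q)) *\<^sub>R x"
      by (simp add: M_def matrix_vector_mult_diff_rdistrib matrix_vector_right_distrib
          matrix_vector_mult_scaleR Dz DBy outer_self_mult_vec xBy xz
          inner_add_right algebra_simps flip: scaleR_matrix_vector_assoc)
    finally show ?thesis by (simp add: c)
  qed
  then have "M ** (B + c *\<^sub>R outer_self z) = mat 1" by (simp add: matrix_eq)
  then have inv: "matrix_inv M = B + c *\<^sub>R outer_self z"
    by (intro matrix_inv_eqI) (simp add: matrix_left_right_inverse)
  have "z \<bullet> z = (\<Sum>i\<in>UNIV. (e i \<bullet> x)\<^sup>2 / (d i)\<^sup>2)"
    unfolding orthonormal_parseval[OF e, of z z] unfolding z_def B_def orthonormal_inner_diag_in[OF e]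
    by (intro sum.cong) (auto simp: power2_eq_square)
  then have "trace (matrix_inv M) = (\<Sum>i\<in>UNIV. 1 / d i) + s * (\<Sum>i\<in>UNIV. (e i \<bullet> x)\<^sup>2 / (d i)\<^sup>2) / (1 - s * q)"
    by (simp add: inv trace_add trace_scaleR trace_outer_self B_def trace_diag_in[OF e] c_def)
  with tr pd show ?thesis by (simp add: edge_set_def eqM d_def)
qed


text \<open>One summand of the trace is at most \<open>\<phi>\<close>, so every eigenvalue keeps
  distance at least \<open>1 / \<phi>\<close> from an admissible level. This separation makes
  resolvents at nearby levels comparable.\<close>

lemma edge_set_diag_in_gap:
  assumes e: "orthonormal_family e" and u: "u \<in> edge_set \<phi> (diag_in e l)"
  shows "l i < u" "(\<Sum>i\<in>UNIV. 1 / (u - l i)) \<le> \<phi>" "1 \<le> (u - l i) * \<phi>"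
proof -
  show lt: "l i < u" and tr: "(\<Sum>i\<in>UNIV. 1 / (u - l i)) \<le> \<phi>" for i
    using u by (auto simp: edge_set_diag_in_iff[OF e])
  have "1 / (u - l i) \<le> (\<Sum>i\<in>UNIV. 1 / (u - l i))"
    using lt by (intro member_le_sum) (auto simp: less_imp_le)
  then have "1 / (u - l i) \<le> \<phi>" using tr by linarith
  then show "1 \<le> (u - l i) * \<phi>" using lt[of i] by (simp add: divide_le_eq mult.commute)
qed

text \<open>Moving the level from \<open>u\<close> to \<open>u + \<delta>\<close> lowers the
  unperturbed trace by exactly \<open>\<delta> * W\<close>, and the last hypothesis keeps the
  rank-one correction within that amount. No smallness of \<open>\<delta>\<close> is assumed, so the
  criterion serves typical increments and the tail of large ones alike.\<close>

lemma edge_set_add_outer_self: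
  assumes e: "orthonormal_family e" and u: "u \<in> edge_set \<phi> (diag_in e l)" and \<delta>: "\<delta> > 0"
    and q1: "(\<Sum>i\<in>UNIV. (e i \<bullet> x)\<^sup>2 / (u - l i + \<delta>)) < 1"
    and W: "W = (\<Sum>i\<in>UNIV. 1 / ((u - l i) * (u - l i + \<delta>)))"
    and q: "(\<Sum>i\<in>UNIV. (e i \<bullet> x)\<^sup>2 / (u - l i + \<delta>))
      + (\<Sum>i\<in>UNIV. (e i \<bullet> x)\<^sup>2 / ((u - l i) * (u - l i + \<delta>))) / W / \<delta> \<le> 1"
  shows "u + \<delta> \<in> edge_set \<phi> (diag_in e l + outer_self x)"
proof -
  define d where "d i = u - l i" for i
  define Q where "Q = (\<Sum>i\<in>UNIV. (e i \<bullet> x)\<^sup>2 / (d i + \<delta>))"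
  have d: "d i > 0" for i using edge_set_diag_in_gap[OF e u] by (simp add: d_def)
  then have d': "d i + \<delta> > 0" "d i * (d i + \<delta>) > 0" for i using \<delta> by (auto simp: add_pos_pos)
  have W: "W = (\<Sum>i\<in>UNIV. 1 / (d i * (d i + \<delta>)))" by (simp add: W d_def)
  have Wpos: "W > 0" unfolding W using d' by (intro sum_pos) auto
  have Q1: "Q < 1" using q1 by (simp add: Q_def d_def)
  \<comment> \<open>The squared resolvent is replaced by the larger mixed product, whose trace is
    \<open>W\<close>.\<close>
  have "(\<Sum>i\<in>UNIV. (e i \<bullet> x)\<^sup>2 / (d i + \<delta>)\<^sup>2) \<le> (\<Sum>i\<in>UNIV. (e i \<bullet> x)\<^sup>2 / (d i * (d i + \<delta>)))"
    using d d' \<delta> by (intro sum_mono divide_left_mono) (auto simp: power2_eq_square intro!: mult_right_mono mult_pos_pos)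
  also have "\<dots> \<le> \<delta> * W * (1 - Q)"
    using q Wpos \<delta> unfolding d_def[symmetric] Q_def[symmetric]
    by (simp add: divide_le_eq le_diff_eq[symmetric] mult_ac flip: le_diff_eq)
      (simp add: field_simps)
  finally have "(\<Sum>i\<in>UNIV. (e i \<bullet> x)\<^sup>2 / (d i + \<delta>)\<^sup>2) / (1 - Q) \<le> \<delta> * W"
    using Q1 by (simp add: divide_le_eq)
  moreover have "\<delta> * W = (\<Sum>i\<in>UNIV. 1 / d i) - (\<Sum>i\<in>UNIV. 1 / (d i + \<delta>))"
    unfolding W sum_distrib_left sum_subtractf[symmetric]
    using d d' by (intro sum.cong) (auto simp: field_simps add_pos_pos less_imp_neq[symmetric] intro!: less_imp_neq[symmetric])
  ultimately have tr: "(\<Sum>i\<in>UNIV. 1 / (d i + \<delta>)) + 1 * (\<Sum>i\<in>UNIV. (e i \<bullet> x)\<^sup>2 / (d i + \<delta>)\<^sup>2) / (1 - 1 * Q) \<le> \<phi>"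
    using edge_set_diag_in_gap(2)[OF e u] by (simp add: d_def)
  have eq: "u + \<delta> - l i = d i + \<delta>" for i by (simp add: d_def)
  have "u + \<delta> \<in> edge_set \<phi> (diag_in e l + 1 *\<^sub>R outer_self x)"
  proof (rule edge_set_rank_one_update[OF e, where q = Q])
    show "l i < u + \<delta>" for i using d'(1)[of i] by (simp add: d_def)
  qed (use Q1 tr in \<open>auto simp: eq Q_def\<close>)
  then show ?thesis by simp
qed

section \<open>Increments of the edge for regular vectors\<close>

context
  fixes e :: "'n::finite \<Rightarrow> real^'n" and l :: "'n \<Rightarrow> real" and u \<phi> \<alpha> :: real and x :: "real^'n"
    and p1 p2 V :: real
  assumes e: "orthonormal_family e" and u: "u \<in> edge_set \<phi> (diag_in e l)"
    and \<alpha>: "0 < \<alpha>" "\<alpha> < 1 / 2"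
    and V: "V = (\<Sum>i\<in>UNIV. 1 / (u - l i)\<^sup>2)"
    and p1: "p1 = (\<Sum>i\<in>UNIV. (e i \<bullet> x)\<^sup>2 / (u - l i))" "p1 \<le> \<alpha>"
    and p2: "p2 = (\<Sum>i\<in>UNIV. (e i \<bullet> x)\<^sup>2 / (u - l i)\<^sup>2) / V" "\<phi> * p2 \<le> \<alpha>"
begin

lemma regular_facts:
  shows "0 < u - l i" "0 < V" "0 \<le> p2" "0 < \<phi>" "1 \<le> (u - l i) * \<phi>"
    "(\<Sum>i\<in>UNIV. (e i \<bullet> x)\<^sup>2 / (u - l i)\<^sup>2) = p2 * V"
proof -
  show gap: "0 < u - l i" for i using edge_set_diag_in_gap[OF e u] by simp
  then have ne: "l i \<noteq> u" for i by (metis diff_self less_irrefl)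
  show "0 < V" unfolding V using ne by (intro sum_pos) auto
  then show "0 \<le> p2" "(\<Sum>i\<in>UNIV. (e i \<bullet> x)\<^sup>2 / (u - l i)\<^sup>2) = p2 * V"
    unfolding p2(1) by (auto intro!: divide_nonneg_nonneg sum_nonneg)
  show "1 \<le> (u - l i) * \<phi>" for i using edge_set_diag_in_gap[OF e u] by simp
  then have "0 < (u - l undefined) * \<phi>" by (meson less_le_trans zero_less_one)
  then show "0 < \<phi>" using gap[of undefined] by (simp add: zero_less_mult_iff)
qed

text \<open>Here \<open>p1\<close> is the quadratic form of the resolvent at \<open>x\<close>, and
  \<open>p2\<close> that of the squared resolvent divided by its trace \<open>V\<close>. As gaps are
  at least \<open>1 / \<phi>\<close> and \<open>\<phi> * p2\<close> is small, the shift stretches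
  each gap by at most the factor \<open>k\<close>; hence \<open>W \<ge> V / k\<close>, and the
  general criterion applies.\<close>

lemma edge_set_add_outer_self_regular:
  "u + p2 / (1 - 2 * \<alpha>) \<in> edge_set \<phi> (diag_in e l + outer_self x)"
\<comment> \<open>The general criterion needs a positive shift; if \<open>p2\<close> vanishes, so
  does \<open>x\<close>.\<close>
proof (cases "p2 = 0")
  case True
  then have "(\<Sum>i\<in>UNIV. (e i \<bullet> x)\<^sup>2 / (u - l i)\<^sup>2) = 0" using regular_facts(6) by simp
  then have "\<forall>i. (e i \<bullet> x)\<^sup>2 / (u - l i)\<^sup>2 = 0"
    by (subst (asm) sum_nonneg_eq_0_iff) auto
  then have "e i \<bullet> x = 0" for i using regular_facts(1)[of i] by auto
  then have "x = 0" using orthonormal_expansion[OF e, of x] by simp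
  then have "outer_self x = 0" by (simp add: outer_self_def vec_eq_iff)
  then show ?thesis using u True by simp
next
  case False
  note gap = regular_facts(1)
  have p2pos: "p2 > 0" using False regular_facts(3) by simp
  define d where "d i = u - l i" for i
  have d: "d i > 0" for i using gap by (simp add: d_def)
  define \<delta> where "\<delta> = p2 / (1 - 2 * \<alpha>)"
  have \<delta>: "\<delta> > 0" using p2pos \<alpha> by (simp add: \<delta>_def)
  have \<delta>\<phi>: "\<delta> * \<phi> * (1 - 2 * \<alpha>) \<le> \<alpha>" using p2(2) \<alpha> by (simp add: \<delta>_def mult.commute)
  \<comment> \<open>The bound on \<open>\<delta> * \<phi>\<close> gives
    \<open>k * (1 - 2 * \<alpha>) \<le> 1 - \<alpha>\<close>, which leaves room
    \<open>\<alpha>\<close> for \<open>p1\<close>.\<close>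
  define k where "k = 1 + \<delta> * \<phi>"
  have k: "k > 0" using \<delta> regular_facts(4) by (simp add: k_def add_pos_pos)
  have dk: "d i + \<delta> \<le> d i * k" for i
    using mult_left_mono[OF regular_facts(5)[of i], of \<delta>] \<delta> by (simp add: k_def d_def algebra_simps)
  define W where "W = (\<Sum>i\<in>UNIV. 1 / (d i * (d i + \<delta>)))"
  have pos: "d i + \<delta> > 0" "d i * (d i + \<delta>) > 0" for i using d \<delta> by (auto simp: add_pos_pos)
  have Wpos: "W > 0" unfolding W_def using pos by (intro sum_pos) auto
  have "V / k = (\<Sum>i\<in>UNIV. 1 / (d i * (d i * k)))"
    unfolding V d_def sum_divide_distrib by (simp add: power2_eq_square mult_ac)
  also have "\<dots> \<le> W"
    unfolding W_def using d dk pos k by (intro sum_mono divide_left_mono mult_left_mono mult_pos_pos) (auto simp: less_imp_le)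
  finally have VW: "V \<le> k * W" using k by (simp add: divide_le_eq mult.commute)
  define Q where "Q = (\<Sum>i\<in>UNIV. (e i \<bullet> x)\<^sup>2 / (d i * (d i + \<delta>)))"
  have "Q \<le> (\<Sum>i\<in>UNIV. (e i \<bullet> x)\<^sup>2 / (d i)\<^sup>2)"
    unfolding Q_def using d pos \<delta>
    by (intro sum_mono divide_left_mono) (auto simp: power2_eq_square less_imp_le intro!: mult_left_mono mult_pos_pos)
  also have "\<dots> = p2 * V" using regular_facts(6) by (simp add: d_def)
  also have "\<dots> \<le> p2 * (k * W)" using VW p2pos by (intro mult_left_mono) auto
  finally have "Q / W \<le> p2 * k" using Wpos by (simp add: divide_le_eq mult_ac)
  then have "Q / W / \<delta> \<le> p2 * k / \<delta>" using \<delta> by (intro divide_right_mono) auto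
  also have "p2 * k / \<delta> = k * (1 - 2 * \<alpha>)" using p2pos by (simp add: \<delta>_def)
  also have "\<dots> \<le> 1 - \<alpha>" using \<delta>\<phi> by (simp add: k_def algebra_simps)
  finally have Q2: "Q / W / \<delta> \<le> 1 - \<alpha>" .
  have "(\<Sum>i\<in>UNIV. (e i \<bullet> x)\<^sup>2 / (d i + \<delta>)) \<le> p1"
    unfolding p1(1) d_def[symmetric] using d pos \<delta>
    by (intro sum_mono divide_left_mono) (auto simp: less_imp_le)
  then have Q1: "(\<Sum>i\<in>UNIV. (e i \<bullet> x)\<^sup>2 / (d i + \<delta>)) \<le> \<alpha>" using p1(2) by linarith
  show ?thesis unfolding \<delta>_def[symmetric]
  proof (rule edge_set_add_outer_self[OF e u \<delta>, where W = W])
    show "W = (\<Sum>i\<in>UNIV. 1 / ((u - l i) * (u - l i + \<delta>)))" by (simp add: W_def d_def)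
  qed (use Q1 Q2 \<alpha> in \<open>auto simp: Q_def d_def\<close>)
qed

text \<open>Lowering the level raises the trace by at most
  \<open>\<delta> * V / (1 - \<alpha>)\<close>, while removing the outer product lowers it by at
  least \<open>(1 - \<alpha>) * (p2 * V)\<close>. The factor in \<open>\<delta>\<close> fits because
  \<open>1 - 2 * \<alpha> \<le> (1 - \<alpha>)\<^sup>2\<close>.\<close>

lemma edge_set_diff_outer_self_regular:
  "u - (1 - 2 * \<alpha>) * p2 \<in> edge_set \<phi> (diag_in e l - outer_self x)"
proof -
  note gap = regular_facts(1) and p20 = regular_facts(3)
  define d where "d i = u - l i" for i
  have d: "d i > 0" for i using gap by (simp add: d_def)
  define \<delta> where "\<delta> = (1 - 2 * \<alpha>) * p2"
  have \<delta>: "\<delta> \<ge> 0" "\<delta> \<le> p2" using p20 \<alpha> by (auto simp: \<delta>_def mult_left_le_one_le)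
  have \<delta>\<phi>: "\<delta> * \<phi> \<le> \<alpha>"
    using mult_left_mono[OF \<delta>(2), of \<phi>] regular_facts(4) p2(2) by (simp only: mult.commute[of \<delta>]) linarith
  \<comment> \<open>The downward shift consumes at most the fraction \<open>\<alpha>\<close> of each
    gap.\<close>
  have dl: "d i * (1 - \<alpha>) \<le> d i - \<delta>" for i
  proof -
    have "\<delta> \<le> \<delta> * (d i * \<phi>)" using mult_left_mono[OF regular_facts(5)[of i], of \<delta>] \<delta> by (simp add: d_def)
    also have "\<dots> = d i * (\<delta> * \<phi>)" by simp
    also have "\<dots> \<le> d i * \<alpha>" using \<delta>\<phi> d[of i] by (intro mult_left_mono) auto
    finally show ?thesis by (simp add: algebra_simps)
  qed
  have al: "1 - \<alpha> > 0" using \<alpha> by simp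
  have pos': "d i * (1 - \<alpha>) > 0" for i using d al by simp
  have pos: "d i - \<delta> > 0" for i using dl[of i] pos'[of i] by linarith
  define Q where "Q = (\<Sum>i\<in>UNIV. (e i \<bullet> x)\<^sup>2 / (d i - \<delta>))"
  define R where "R = (\<Sum>i\<in>UNIV. (e i \<bullet> x)\<^sup>2 / (d i - \<delta>)\<^sup>2)"
  have Q0: "Q \<ge> 0" unfolding Q_def using pos by (intro sum_nonneg divide_nonneg_pos) auto
  have "Q \<le> (\<Sum>i\<in>UNIV. (e i \<bullet> x)\<^sup>2 / (d i * (1 - \<alpha>)))"
    unfolding Q_def using d al dl pos pos' by (intro sum_mono divide_left_mono mult_pos_pos) auto
  also have "\<dots> = p1 / (1 - \<alpha>)" unfolding p1(1) d_def sum_divide_distrib by simp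
  also have "\<dots> \<le> \<alpha> / (1 - \<alpha>)" using p1(2) al by (intro divide_right_mono) auto
  finally have "1 + Q \<le> 1 / (1 - \<alpha>)" using al by (simp add: field_simps)
  then have Q1: "(1 - \<alpha>) * (1 + Q) \<le> 1" using al by (simp add: field_simps)
  have "p2 * V = (\<Sum>i\<in>UNIV. (e i \<bullet> x)\<^sup>2 / (d i)\<^sup>2)" using regular_facts(6) by (simp add: d_def)
  also have "\<dots> \<le> R"
    unfolding R_def using d pos \<delta> by (intro sum_mono divide_left_mono power_mono mult_pos_pos zero_less_power) (auto simp: less_imp_le)
  finally have R: "p2 * V \<le> R" .
  have "(1 - \<alpha>) * (p2 * V) * (1 + Q) \<le> 1 * (p2 * V)"
    using mult_right_mono[OF Q1, of "p2 * V"] p20 regular_facts(2) by (simp add: mult_ac)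
  also have "\<dots> \<le> R" using R by simp
  finally have R': "(1 - \<alpha>) * (p2 * V) \<le> R / (1 + Q)" using Q0 by (simp add: le_divide_eq)
  have "(\<Sum>i\<in>UNIV. 1 / (d i - \<delta>)) - (\<Sum>i\<in>UNIV. 1 / d i) = (\<Sum>i\<in>UNIV. \<delta> / (d i * (d i - \<delta>)))"
    unfolding sum_subtractf[symmetric]
  proof (intro sum.cong refl)
    fix i show "1 / (d i - \<delta>) - 1 / d i = \<delta> / (d i * (d i - \<delta>))"
      using d[of i] pos[of i] by (simp add: field_simps)
  qed
  also have "\<dots> \<le> (\<Sum>i\<in>UNIV. \<delta> / (d i * (d i * (1 - \<alpha>))))"
    using d al pos pos' dl \<delta> by (intro sum_mono divide_left_mono mult_left_mono mult_pos_pos) (auto simp: less_imp_le)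
  also have "\<dots> = \<delta> * V / (1 - \<alpha>)"
    unfolding V d_def sum_divide_distrib sum_distrib_left by (simp add: power2_eq_square mult_ac)
  also have "\<dots> \<le> (1 - \<alpha>) * (p2 * V)"
  proof -
    have "(1 - 2 * \<alpha>) * (p2 * V) \<le> (1 - \<alpha>)\<^sup>2 * (p2 * V)"
      using p20 regular_facts(2) by (intro mult_right_mono) (auto simp: power2_eq_square algebra_simps)
    then show ?thesis using al by (simp add: \<delta>_def divide_le_eq power2_eq_square mult_ac)
  qed
  finally have "(\<Sum>i\<in>UNIV. 1 / (d i - \<delta>)) - (\<Sum>i\<in>UNIV. 1 / d i) \<le> R / (1 + Q)" using R' by linarith
  then have tr: "(\<Sum>i\<in>UNIV. 1 / (d i - \<delta>)) + (- 1) * R / (1 - (- 1) * Q) \<le> \<phi>"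
    using edge_set_diag_in_gap(2)[OF e u] by (simp add: d_def)
  have eq: "u - \<delta> - l i = d i - \<delta>" for i by (simp add: d_def)
  have "u - \<delta> \<in> edge_set \<phi> (diag_in e l + (- 1) *\<^sub>R outer_self x)"
  proof (rule edge_set_rank_one_update[OF e, where q = Q])
    show "l i < u - \<delta>" for i using pos[of i] by (simp add: d_def)
  qed (use Q0 tr in \<open>auto simp: eq Q_def R_def\<close>)
  then show ?thesis by (simp add: \<delta>_def)
qed

end

subsection \<open>Tails of quadratic forms\<close>

text \<open>Discrete layer cake: the minimum of \<open>g\<close> becomes the weight of the whole
  set, and induction treats the rest after removal of the minimiser. For eigenvalues
  \<open>g\<close> the indicators are orthogonal projections in the eigenbasis.\<close>

lemma layer_decomposition:
  fixes g :: "'i \<Rightarrow> real"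
  assumes "finite E" "\<And>i. i \<in> E \<Longrightarrow> 0 \<le> g i" "\<And>i. i \<in> E \<Longrightarrow> g i \<le> m" "0 \<le> m"
  shows "\<exists>c. (\<forall>F. 0 \<le> c F) \<and> (\<forall>i\<in>E. g i = (\<Sum>F\<in>Pow E. c F * indicator F i)) \<and> (\<Sum>F\<in>Pow E. c F) \<le> m"
  using assms
proof (induction "card E" arbitrary: E g m)
  case 0
  then show ?case by (intro exI[of _ "\<lambda>_. 0"]) auto
next
  case (Suc k)
  then have "E \<noteq> {}" by auto
  then obtain j where j: "j \<in> E" "\<And>i. i \<in> E \<Longrightarrow> g j \<le> g i"
    using Suc.prems(1) arg_min_if_finite[of E g] by (metis leI)
  define E' where "E' = E - {j}"
  have E': "finite E'" "k = card E'" "E' \<subseteq> E" "E \<notin> Pow E'"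
    using Suc.prems(1) Suc.hyps(2) j(1) by (auto simp: E'_def)
  have "\<exists>c. (\<forall>F. 0 \<le> c F) \<and> (\<forall>i\<in>E'. g i - g j = (\<Sum>F\<in>Pow E'. c F * indicator F i))
      \<and> (\<Sum>F\<in>Pow E'. c F) \<le> m - g j"
    using Suc.prems j E'(3) by (intro Suc.hyps(1)[OF E'(2,1)]) auto
  then obtain c where c: "\<And>F. 0 \<le> c F" "\<And>i. i \<in> E' \<Longrightarrow> g i - g j = (\<Sum>F\<in>Pow E'. c F * indicator F i)"
    "(\<Sum>F\<in>Pow E'. c F) \<le> m - g j" by blast
  \<comment> \<open>Since \<open>E\<close> is not a subset of \<open>E'\<close>, the new weight does
    not collide with those of the induction hypothesis.\<close>
  define c' where "c' F = (if F = E then g j else if F \<subseteq> E' then c F else 0)" for F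
  have split: "(\<Sum>F\<in>Pow E. c' F * h F) = g j * h E + (\<Sum>F\<in>Pow E'. c F * h F)" for h :: "'i set \<Rightarrow> real"
  proof -
    have "(\<Sum>F\<in>Pow E. c' F * h F) = (\<Sum>F\<in>insert E (Pow E'). c' F * h F)"
      using Suc.prems(1) E'(3) by (intro sum.mono_neutral_right) (auto simp: c'_def)
    also have "\<dots> = c' E * h E + (\<Sum>F\<in>Pow E'. c' F * h F)"
      using E'(1,4) by (intro sum.insert) auto
    also have "(\<Sum>F\<in>Pow E'. c' F * h F) = (\<Sum>F\<in>Pow E'. c F * h F)"
      using E'(4) by (intro sum.cong) (auto simp: c'_def)
    finally show ?thesis by (simp add: c'_def)
  qed
  have "0 \<le> c' F" for F using c(1) Suc.prems(2)[OF j(1)] by (simp add: c'_def)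
  moreover have "g i = (\<Sum>F\<in>Pow E. c' F * indicator F i)" if "i \<in> E" for i
  proof (cases "i = j")
    case True
    have "(\<Sum>F\<in>Pow E'. c F * indicator F i) = 0"
      using True by (intro sum.neutral) (auto simp: E'_def indicator_def)
    then show ?thesis using that True by (simp add: split)
  next
    case False
    then have "i \<in> E'" using that by (simp add: E'_def)
    then show ?thesis using c(2)[of i] that by (simp add: split)
  qed
  moreover have "(\<Sum>F\<in>Pow E. c' F) \<le> m" using split[of "\<lambda>_. 1"] c(3) by simp
  ultimately show ?case by (intro exI[of _ c']) auto
qed

text \<open>By Tonelli the mean excess is the integral of the tail probability over
  \<open>t > T\<close>, and the power bound has an explicit antiderivative.\<close>

lemma (in prob_space) expectation_excess_le:
  fixes Z :: "'a \<Rightarrow> real"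
  assumes Z: "integrable M Z" and T: "T > 0" and K: "K \<ge> 0" and \<eta>: "\<eta> > 0"
    and tail: "\<And>t. t > T \<Longrightarrow> prob {\<omega> \<in> space M. Z \<omega> > t} \<le> K * t powr (- 1 - \<eta>)"
  shows "expectation (\<lambda>\<omega>. max 0 (Z \<omega> - T)) \<le> K * T powr (- \<eta>) / \<eta>"
proof -
  have [measurable]: "Z \<in> borel_measurable M" using Z by simp
  interpret pair_sigma_finite M lborel ..
  \<comment> \<open>The excess is the length of the interval from \<open>T\<close> to
    \<open>z\<close>, which prepares the exchange of integrals.\<close>
  have ind: "ennreal (max 0 (z - T)) = (\<integral>\<^sup>+t. indicator {x. T < x \<and> x < z} t \<partial>lborel)" for z :: real
  proof -
    have "(\<integral>\<^sup>+t. indicator {x. T < x \<and> x < z} t \<partial>lborel) = emeasure lborel {T<..<z}"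
      by (subst nn_integral_indicator) (auto simp: greaterThanLessThan_def greaterThan_def lessThan_def
          intro!: arg_cong[where f = "emeasure lborel"])
    also have "\<dots> = ennreal (max 0 (z - T))"
      by (cases "T \<le> z") (auto simp: max_def)
    finally show ?thesis by simp
  qed
  have "(\<integral>\<^sup>+\<omega>. ennreal (max 0 (Z \<omega> - T)) \<partial>M)
      = (\<integral>\<^sup>+\<omega>. \<integral>\<^sup>+t. indicator {x. T < x \<and> x < Z \<omega>} t \<partial>lborel \<partial>M)"
    by (simp only: ind)
  also have "\<dots> = (\<integral>\<^sup>+\<omega>. \<integral>\<^sup>+t. (\<lambda>(\<omega>, t). indicator {p \<in> space (M \<Otimes>\<^sub>M lborel). T < snd p \<and> snd p < Z (fst p)} (\<omega>, t)) (\<omega>, t) \<partial>lborel \<partial>M)"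
    by (intro nn_integral_cong) (auto simp: indicator_def space_pair_measure)
  also have "\<dots> = (\<integral>\<^sup>+t. \<integral>\<^sup>+\<omega>. (\<lambda>(\<omega>, t). indicator {p \<in> space (M \<Otimes>\<^sub>M lborel). T < snd p \<and> snd p < Z (fst p)} (\<omega>, t)) (\<omega>, t) \<partial>M \<partial>lborel)"
    by (rule Fubini[symmetric]) measurable
  also have "\<dots> \<le> (\<integral>\<^sup>+t. ennreal (K * t powr (- 1 - \<eta>)) * indicator {T..} t \<partial>lborel)"
  proof (intro nn_integral_mono)
    fix t
    have "(\<integral>\<^sup>+\<omega>. (\<lambda>(\<omega>, t). indicator {p \<in> space (M \<Otimes>\<^sub>M lborel). T < snd p \<and> snd p < Z (fst p)} (\<omega>, t)) (\<omega>, t) \<partial>M)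
        = (\<integral>\<^sup>+\<omega>. indicator {T<..} t * indicator {\<omega> \<in> space M. t < Z \<omega>} \<omega> \<partial>M)"
      by (intro nn_integral_cong) (auto simp: indicator_def space_pair_measure)
    also have "\<dots> = indicator {T<..} t * emeasure M {\<omega> \<in> space M. t < Z \<omega>}"
      by (subst nn_integral_cmult) auto
    also have "\<dots> \<le> ennreal (K * t powr (- 1 - \<eta>)) * indicator {T..} t"
      using tail[of t] by (auto simp: indicator_def emeasure_eq_measure intro!: ennreal_leI)
    finally show "(\<integral>\<^sup>+\<omega>. (\<lambda>(\<omega>, t). indicator {p \<in> space (M \<Otimes>\<^sub>M lborel). T < snd p \<and> snd p < Z (fst p)} (\<omega>, t)) (\<omega>, t) \<partial>M)
      \<le> ennreal (K * t powr (- 1 - \<eta>)) * indicator {T..} t" .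
  qed
  also have "\<dots> = ennreal (0 - (- (K * T powr (- \<eta>) / \<eta>)))"
  proof (rule nn_integral_FTC_atLeast)
    show "(\<lambda>t. K * t powr (- 1 - \<eta>)) \<in> borel_measurable borel" by measurable
    fix t assume t: "T \<le> t"
    then have "t > 0" using T by simp
    then show "((\<lambda>t. - (K * t powr (- \<eta>) / \<eta>)) has_real_derivative K * t powr (- 1 - \<eta>)) (at t)"
      using \<eta> by (auto intro!: derivative_eq_intros simp: algebra_simps minus_diff_commute[of \<eta>])
    show "0 \<le> K * t powr (- 1 - \<eta>)" using K by simp
  next
    have "((\<lambda>t. t powr (- \<eta>)) \<longlongrightarrow> 0) at_top"
      using \<eta> by (intro tendsto_neg_powr filterlim_ident) auto
    then have "((\<lambda>t. - (K / \<eta> * t powr (- \<eta>))) \<longlongrightarrow> - (K / \<eta> * 0)) at_top"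
      by (intro tendsto_intros)
    then show "((\<lambda>t. - (K * t powr (- \<eta>) / \<eta>)) \<longlongrightarrow> 0) at_top" by simp
  qed
  finally have "(\<integral>\<^sup>+\<omega>. ennreal (max 0 (Z \<omega> - T)) \<partial>M) \<le> ennreal (K * T powr (- \<eta>) / \<eta>)" by simp
  moreover have "(\<integral>\<^sup>+\<omega>. ennreal (max 0 (Z \<omega> - T)) \<partial>M) = ennreal (expectation (\<lambda>\<omega>. max 0 (Z \<omega> - T)))"
    using Z by (intro nn_integral_eq_integral integrable_max) auto
  ultimately show ?thesis using K \<eta> by (simp add: ennreal_le_iff)
qed

section \<open>Excess and tail bounds for quadratic forms of one isotropic vector\<close>

locale isotropic_tail = prob_space M
  for M :: "'a measure" +
  fixes X :: "'a \<Rightarrow> real ^ 'n" and C \<eta> :: real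
  assumes isotropic: "isotropic M X" and C: "C > 0" and \<eta>: "\<eta> > 0"
    and tail: "\<And>(P :: real ^ 'n ^ 'n) t. orthogonal_projection P \<Longrightarrow> t > C * real (rank P) \<Longrightarrow>
           \<P>(\<omega> in M. (norm (P *v X \<omega>))\<^sup>2 > t) \<le> C * t powr (- 1 - \<eta>)"
begin

lemma X_measurable [measurable]: "X \<in> borel_measurable M"
  using isotropic by (simp add: isotropic_def)

text \<open>The bounded linear functional sending \<open>A\<close> to
  \<open>v \<bullet> (A *v v)\<close> commutes with the expectation.\<close>

lemma has_expectation_inner_square: "has_bochner_integral M (\<lambda>\<omega>. (v \<bullet> X \<omega>)\<^sup>2) (v \<bullet> v)"
proof -
  have "bounded_linear (\<lambda>A :: real^'n^'n. v \<bullet> (A *v v))"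
    by (auto intro!: linear_conv_bounded_linear[THEN iffD1] linearI
        simp: matrix_vector_mult_add_rdistrib inner_add_right simp flip: scaleR_matrix_vector_assoc)
  from has_bochner_integral_bounded_linear[OF this, of M "\<lambda>\<omega>. outer_self (X \<omega>)" "mat 1"]
  show ?thesis using isotropic by (simp add: isotropic_def inner_outer_self inner_commute)
qed

lemma integrable_inner_square [simp]: "integrable M (\<lambda>\<omega>. (v \<bullet> X \<omega>)\<^sup>2)"
  and expectation_inner_square: "expectation (\<lambda>\<omega>. (v \<bullet> X \<omega>)\<^sup>2) = v \<bullet> v"
  using has_expectation_inner_square has_bochner_integral_iff by blast+

text \<open>The sum over \<open>F\<close> is the squared norm of the projection of \<open>X\<close>
  onto the span of the \<open>e i\<close> with \<open>i\<close> in \<open>F\<close>. Its rank is at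
  most \<open>card F\<close>, so the tail hypothesis covers all levels above
  \<open>T\<close>.\<close>

lemma projection_excess:
  fixes e :: "'n \<Rightarrow> real^'n"
  assumes e: "orthonormal_family e" and T: "T > 0" "T \<ge> C * real (card F)"
  shows "expectation (\<lambda>\<omega>. max 0 ((\<Sum>i\<in>F. (e i \<bullet> X \<omega>)\<^sup>2) - T)) \<le> C * T powr (- \<eta>) / \<eta>"
proof (rule expectation_excess_le)
  define P where "P = diag_in e (indicator F)"
  have proj: "orthogonal_projection P"
    unfolding orthogonal_projection_def P_def by (simp add: diag_in_mult[OF e] flip: indicator_inter_arith)
  have "range (\<lambda>x. P *v x) \<subseteq> span (e ` F)"
  proof safe
    fix x
    have "P *v x = (\<Sum>i\<in>F. (e i \<bullet> x) *\<^sub>R e i)"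
      unfolding P_def diag_in_mult_vec by (intro sum.mono_neutral_cong_right) auto
    then show "P *v x \<in> span (e ` F)" by (simp add: span_sum span_scale span_base)
  qed
  then have "rank P \<le> card (e ` F)"
    unfolding rank_dim_range by (metis dim_le_card finite_imageI finite)
  also have "\<dots> \<le> card F" by (rule card_image_le) simp
  finally have rank: "C * real (rank P) \<le> C * real (card F)" using C by simp
  have norm: "(norm (P *v x))\<^sup>2 = (\<Sum>i\<in>F. (e i \<bullet> x)\<^sup>2)" for x
    unfolding power2_norm_eq_inner orthonormal_parseval[OF e, of "P *v x" "P *v x"]
    unfolding P_def orthonormal_inner_diag_in[OF e]
    by (intro sum.mono_neutral_cong_right) (auto simp: power2_eq_square)
  fix t assume "t > T"
  then have "t > C * real (rank P)" using T rank by linarith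
  from tail[OF proj this]
  show "prob {\<omega> \<in> space M. t < (\<Sum>i\<in>F. (e i \<bullet> X \<omega>)\<^sup>2)} \<le> C * t powr (- 1 - \<eta>)"
    by (simp add: norm)
qed (use T C \<eta> in auto)

text \<open>The weights are split into layers \<open>F\<close> with thresholds
  \<open>C * real (card F) + h\<close>; weighted, these add up to at most \<open>T\<close>, and the
  positive part is subadditive. Each threshold is at least \<open>h\<close>, which bounds the excess
  of every layer, and the layers have total weight at most \<open>m\<close>. The dimension enters
  only through the trace \<open>sum g UNIV\<close>.\<close>

lemma weighted_excess:
  fixes e :: "'n \<Rightarrow> real^'n"
  assumes e: "orthonormal_family e" and g: "\<And>i. 0 \<le> g i" "\<And>i. g i \<le> m" and h: "h > 0"
    and T: "C * sum g UNIV + h * m \<le> T"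
  shows "expectation (\<lambda>\<omega>. max 0 ((\<Sum>i\<in>UNIV. g i * (e i \<bullet> X \<omega>)\<^sup>2) - T)) \<le> m * C * h powr (- \<eta>) / \<eta>"
proof -
  have m: "0 \<le> m" using g order_trans by blast
  obtain c where c: "\<And>F. 0 \<le> c F" "\<And>i. g i = (\<Sum>F\<in>UNIV. c F * indicator F i)" "(\<Sum>F\<in>UNIV. c F) \<le> m"
    using layer_decomposition[of "UNIV :: 'n set" g m] g m by auto
  have layers: "(\<Sum>i\<in>UNIV. g i * y i) = (\<Sum>F\<in>UNIV. c F * (\<Sum>i\<in>F. y i))" for y :: "'n \<Rightarrow> real"
  proof -
    have "(\<Sum>i\<in>UNIV. g i * y i) = (\<Sum>F\<in>UNIV. \<Sum>i\<in>UNIV. c F * indicator F i * y i)"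
      unfolding c(2) sum_distrib_right by (rule sum.swap)
    also have "\<dots> = (\<Sum>F\<in>UNIV. c F * (\<Sum>i\<in>F. y i))"
      unfolding sum_distrib_left by (intro sum.cong refl sum.mono_neutral_cong_right) auto
    finally show ?thesis .
  qed
  have sumg: "sum g UNIV = (\<Sum>F\<in>UNIV. c F * real (card F))" using layers[of "\<lambda>_. 1"] by simp
  have T': "(\<Sum>F\<in>UNIV. c F * (C * real (card F) + h)) \<le> T"
  proof -
    have "(\<Sum>F\<in>UNIV. c F * (C * real (card F) + h)) = C * sum g UNIV + h * (\<Sum>F\<in>UNIV. c F)"
      by (simp add: sumg algebra_simps sum.distrib sum_distrib_left)
    also have "\<dots> \<le> C * sum g UNIV + h * m" using c(3) h by simp
    finally show ?thesis using T by linarith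
  qed
  let ?Y = "\<lambda>F \<omega>. max 0 ((\<Sum>i\<in>F. (e i \<bullet> X \<omega>)\<^sup>2) - (C * real (card F) + h))"
  have "expectation (\<lambda>\<omega>. max 0 ((\<Sum>i\<in>UNIV. g i * (e i \<bullet> X \<omega>)\<^sup>2) - T))
      \<le> expectation (\<lambda>\<omega>. \<Sum>F\<in>UNIV. c F * ?Y F \<omega>)"
  proof (rule integral_mono)
    fix \<omega>
    have "(\<Sum>i\<in>UNIV. g i * (e i \<bullet> X \<omega>)\<^sup>2) - T
        \<le> (\<Sum>F\<in>UNIV. c F * ((\<Sum>i\<in>F. (e i \<bullet> X \<omega>)\<^sup>2) - (C * real (card F) + h)))"
      using T' by (simp add: layers right_diff_distrib sum_subtractf)
    also have "\<dots> \<le> (\<Sum>F\<in>UNIV. c F * ?Y F \<omega>)"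
      using c(1) by (intro sum_mono mult_left_mono) auto
    finally have "(\<Sum>i\<in>UNIV. g i * (e i \<bullet> X \<omega>)\<^sup>2) - T \<le> (\<Sum>F\<in>UNIV. c F * ?Y F \<omega>)" .
    moreover have "0 \<le> (\<Sum>F\<in>UNIV. c F * ?Y F \<omega>)"
      using c(1) by (intro sum_nonneg mult_nonneg_nonneg) auto
    ultimately show "max 0 ((\<Sum>i\<in>UNIV. g i * (e i \<bullet> X \<omega>)\<^sup>2) - T) \<le> (\<Sum>F\<in>UNIV. c F * ?Y F \<omega>)"
      by simp
  qed auto
  also have "\<dots> = (\<Sum>F\<in>UNIV. c F * expectation (?Y F))" by simp
  also have "\<dots> \<le> (\<Sum>F\<in>UNIV. c F * (C * h powr (- \<eta>) / \<eta>))"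
  proof (intro sum_mono mult_left_mono c(1))
    fix F :: "'n set"
    have pos: "0 < C * real (card F) + h" using C h by (simp add: add_nonneg_pos)
    have "expectation (?Y F) \<le> C * (C * real (card F) + h) powr (- \<eta>) / \<eta>"
      using pos h by (intro projection_excess[OF e]) auto
    also have "\<dots> \<le> C * h powr (- \<eta>) / \<eta>"
      using C \<eta> h by (intro divide_right_mono mult_left_mono powr_mono2') auto
    finally show "expectation (?Y F) \<le> C * h powr (- \<eta>) / \<eta>" .
  qed
  also have "\<dots> = (\<Sum>F\<in>UNIV. c F) * (C * h powr (- \<eta>) / \<eta>)"
    by (rule sum_distrib_right[symmetric])
  also have "\<dots> \<le> m * (C * h powr (- \<eta>) / \<eta>)"
    using c(3) C \<eta> by (intro mult_right_mono) auto
  finally show ?thesis by simp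
qed

text \<open>Markov's inequality for the excess over \<open>T - s\<close>: the margin
  \<open>h\<close> pays for the projection tails and \<open>s\<close> for Markov.\<close>

lemma weighted_tail:
  fixes e :: "'n \<Rightarrow> real^'n"
  assumes e: "orthonormal_family e" and g: "\<And>i. 0 \<le> g i" "\<And>i. g i \<le> m" and h: "h > 0" and s: "s > 0"
    and T: "C * sum g UNIV + h * m + s \<le> T"
  shows "prob {\<omega> \<in> space M. T < (\<Sum>i\<in>UNIV. g i * (e i \<bullet> X \<omega>)\<^sup>2)} \<le> m * C * h powr (- \<eta>) / (\<eta> * s)"
proof -
  let ?Y = "\<lambda>\<omega>. max 0 ((\<Sum>i\<in>UNIV. g i * (e i \<bullet> X \<omega>)\<^sup>2) - (T - s))"
  have "prob {\<omega> \<in> space M. T < (\<Sum>i\<in>UNIV. g i * (e i \<bullet> X \<omega>)\<^sup>2)} \<le> prob {\<omega> \<in> space M. s \<le> ?Y \<omega>}"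
    by (intro finite_measure_mono) auto
  also have "\<dots> \<le> expectation ?Y / s"
    using s by (intro integral_Markov_inequality_measure[where A = "{}"]) auto
  also have "\<dots> \<le> (m * C * h powr (- \<eta>) / \<eta>) / s"
    using s T by (intro divide_right_mono weighted_excess[OF e g h]) auto
  finally show ?thesis by (simp add: field_simps)
qed

end

subsection \<open>One step\<close>

lemma one_plus_inverse_powr_le:
  fixes \<eta> :: real
  assumes "\<eta> > 0"
  shows "(1 + 1 / \<eta>) powr \<eta> \<le> exp 1"
proof -
  have "\<eta> * ln (1 + 1 / \<eta>) \<le> \<eta> * (1 / \<eta>)"
    using assms by (intro mult_left_mono ln_add_one_self_le_self) auto
  then have "exp (\<eta> * ln (1 + 1 / \<eta>)) \<le> exp 1" using assms by simp
  then show ?thesis using assms by (simp add: powr_def add_pos_pos less_imp_neq[symmetric])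
qed

lemma continuous_on_symmetric_if_lipschitz:
  fixes F :: "real^'n^'n \<Rightarrow> real"
  assumes "\<And>A A'. transpose A = A \<Longrightarrow> transpose A' = A' \<Longrightarrow> \<bar>F A - F A'\<bar> \<le> norm (A - A')"
  shows "continuous_on {A. transpose A = A} F"
  unfolding continuous_on_iff
proof safe
  fix A :: "real^'n^'n" and r :: real assume A: "transpose A = A" and r: "r > 0"
  have "dist (F A') (F A) < r" if "transpose A' = A'" "dist A' A < r" for A'
    using assms[OF that(1) A] that(2) by (simp add: dist_norm)
  then show "\<exists>d>0. \<forall>A'\<in>{A. transpose A = A}. dist A' A < d \<longrightarrow> dist (F A') (F A) < r"
    using r by blast
qed

lemma continuous_on_outer_self: "continuous_on S (\<lambda>x :: real^'n. outer_self x)"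
  unfolding outer_self_def by (intro continuous_intros)

context isotropic_tail
begin

text \<open>Isotropy keeps \<open>C\<close> away from \<open>0\<close>; otherwise \<open>C_main\<close> would be too small for the argument.\<close>

lemma one_le_tail_constant: "1 \<le> exp 1 * (C * (1 + 1 / \<eta>))"
proof -
  define r where "r = 1 + 1 / \<eta>"
  have r: "r > 1" using \<eta> by (simp add: r_def)
  have "1 \<le> exp 1 * (C * r)"
  \<comment> \<open>The threshold \<open>1 / r\<close> is admissible for a projection of rank one
    when \<open>C * r \<le> 1\<close>; otherwise the claim is immediate.\<close>
  proof (cases "C * r \<le> 1")
    case True
    define e :: "'n \<Rightarrow> real^'n" where "e = (\<lambda>i. axis i 1)"
    have e: "orthonormal_family e" by (simp add: orthonormal_family_def e_def inner_axis_axis)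
    define Y where "Y \<omega> = (e undefined \<bullet> X \<omega>)\<^sup>2" for \<omega>
    have [simp]: "integrable M Y" unfolding Y_def[abs_def] by simp
    have "expectation (\<lambda>\<omega>. max 0 (Y \<omega> - 1 / r)) \<le> C * (1 / r) powr (- \<eta>) / \<eta>"
      using projection_excess[OF e, of "1 / r" "{undefined}"] True r by (simp add: Y_def le_divide_eq)
    also have "(1 / r) powr (- \<eta>) = r powr \<eta>" using r by (simp add: powr_divide powr_minus)
    finally have ex: "expectation (\<lambda>\<omega>. max 0 (Y \<omega> - 1 / r)) \<le> C * r powr \<eta> / \<eta>" .
    have "1 = expectation Y"
      using e by (simp add: Y_def[abs_def] expectation_inner_square orthonormal_family_def)
    also have "\<dots> \<le> expectation (\<lambda>\<omega>. 1 / r + max 0 (Y \<omega> - 1 / r))"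
      by (intro integral_mono Bochner_Integration.integrable_add integrable_max) auto
    also have "\<dots> = 1 / r + expectation (\<lambda>\<omega>. max 0 (Y \<omega> - 1 / r))" by (simp add: prob_space)
    finally have "1 - 1 / r \<le> C * r powr \<eta> / \<eta>" using ex by linarith
    then have "\<eta> * (1 - 1 / r) \<le> C * r powr \<eta>" using \<eta> by (simp add: field_simps)
    moreover have "\<eta> * (1 - 1 / r) = 1 / r" using \<eta> by (simp add: r_def field_simps)
    ultimately have "1 \<le> C * r * r powr \<eta>" using r by (simp add: field_simps)
    also have "\<dots> \<le> C * r * exp 1"
      using C r one_plus_inverse_powr_le[OF \<eta>] by (intro mult_left_mono) (auto simp: r_def)
    finally show ?thesis by (simp add: mult_ac)
  next
    case False
    have "1 * 1 \<le> exp 1 * (C * r)" using False by (intro mult_mono) auto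
    then show ?thesis by simp
  qed
  then show ?thesis by (simp add: r_def)
qed

text \<open>The Lipschitz bound gives measurability through continuity, and an integrable majorant
  linear in the norm of the outer product. The signs \<open>s = 1\<close> and \<open>s = - 1\<close>
  serve the two edges.\<close>

lemma integrable_soft_edge:
  assumes "\<phi> > 0" and A: "transpose A = A"
  shows "integrable M (\<lambda>\<omega>. soft_edge \<phi> (A + s *\<^sub>R outer_self (X \<omega>)))"
proof -
  have sym: "transpose (A + s *\<^sub>R outer_self x) = A + s *\<^sub>R outer_self x" for x
    by (simp add: transpose_add transpose_scalar A)
  have "continuous_on UNIV (\<lambda>x. soft_edge \<phi> (A + s *\<^sub>R outer_self x))"
    using sym by (intro continuous_on_compose2[OF
          continuous_on_symmetric_if_lipschitz[OF soft_edge_lipschitz[OF assms(1)]]]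
        continuous_intros continuous_on_outer_self) auto
  then have "(\<lambda>x. soft_edge \<phi> (A + s *\<^sub>R outer_self x)) \<in> borel_measurable borel"
    by (rule borel_measurable_continuous_onI)
  then have meas: "(\<lambda>\<omega>. soft_edge \<phi> (A + s *\<^sub>R outer_self (X \<omega>))) \<in> borel_measurable M"
    using X_measurable by (rule measurable_compose[rotated])
  have "integrable M (\<lambda>\<omega>. outer_self (X \<omega>))"
    using isotropic by (simp add: isotropic_def has_bochner_integral_iff)
  then have "integrable M (\<lambda>\<omega>. \<bar>soft_edge \<phi> A\<bar> + \<bar>s\<bar> * norm (outer_self (X \<omega>)))" by simp
  then show ?thesis
  proof (rule Bochner_Integration.integrable_bound[OF _ meas], intro AE_I2)
    fix \<omega>
    have "\<bar>soft_edge \<phi> (A + s *\<^sub>R outer_self (X \<omega>)) - soft_edge \<phi> A\<bar> \<le> \<bar>s\<bar> * norm (outer_self (X \<omega>))"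
      using soft_edge_lipschitz[OF assms(1) sym A, of "X \<omega>"] by simp
    then show "norm (soft_edge \<phi> (A + s *\<^sub>R outer_self (X \<omega>)))
        \<le> norm (\<bar>soft_edge \<phi> A\<bar> + \<bar>s\<bar> * norm (outer_self (X \<omega>)))"
      by simp
  qed
qed

section \<open>Expected increment of the edge for one random vector\<close>

context
  fixes e :: "'n \<Rightarrow> real^'n" and l :: "'n \<Rightarrow> real" and u \<phi> \<alpha> D V :: real and p1 p2 :: "'a \<Rightarrow> real"
  assumes e: "orthonormal_family e" and u: "u \<in> edge_set \<phi> (diag_in e l)"
    and \<alpha>: "0 < \<alpha>" "\<alpha> \<le> 1 / 4" and D: "D > 0" "8 * C \<le> D" and \<phi>: "\<phi> = \<alpha> / (4 * D)"
    and V: "V = (\<Sum>i\<in>UNIV. 1 / (u - l i)\<^sup>2)"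
    and p1: "p1 = (\<lambda>\<omega>. \<Sum>i\<in>UNIV. (e i \<bullet> X \<omega>)\<^sup>2 / (u - l i))"
    and p2: "p2 = (\<lambda>\<omega>. (\<Sum>i\<in>UNIV. (e i \<bullet> X \<omega>)\<^sup>2 / (u - l i)\<^sup>2) / V)"
begin

lemma step_facts:
  shows "0 < u - l i" "(\<Sum>i\<in>UNIV. 1 / (u - l i)) \<le> \<phi>" "1 / (u - l i) \<le> \<phi>" "0 < \<phi>" "C * \<phi> \<le> \<alpha> / 32" "0 < V"
    "p1 \<omega> = (\<Sum>i\<in>UNIV. 1 / (u - l i) * (e i \<bullet> X \<omega>)\<^sup>2)"
    "p2 \<omega> = (\<Sum>i\<in>UNIV. (1 / (u - l i)\<^sup>2 / V) * (e i \<bullet> X \<omega>)\<^sup>2)"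
    "0 \<le> p2 \<omega>"
proof -
  show gap: "0 < u - l i" for i using edge_set_diag_in_gap[OF e u] by simp
  show "(\<Sum>i\<in>UNIV. 1 / (u - l i)) \<le> \<phi>" using edge_set_diag_in_gap[OF e u] by simp
  show "1 / (u - l i) \<le> \<phi>"
    using edge_set_diag_in_gap(3)[OF e u, of i] gap[of i] by (simp add: divide_le_eq mult.commute)
  show "0 < \<phi>" using \<alpha> D by (simp add: \<phi>)
  have "C * \<alpha> \<le> D / 8 * \<alpha>" using \<alpha> D by (intro mult_right_mono) auto
  then show "C * \<phi> \<le> \<alpha> / 32" using D by (simp add: \<phi> divide_le_eq mult.commute)
  have ne: "l i \<noteq> u" for i using gap[of i] by auto
  show Vpos: "0 < V" unfolding V using ne by (intro sum_pos) auto
  show "p1 \<omega> = (\<Sum>i\<in>UNIV. 1 / (u - l i) * (e i \<bullet> X \<omega>)\<^sup>2)" by (simp add: p1)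
  show "p2 \<omega> = (\<Sum>i\<in>UNIV. (1 / (u - l i)\<^sup>2 / V) * (e i \<bullet> X \<omega>)\<^sup>2)"
    by (simp add: p2 sum_divide_distrib mult_ac)
  show "0 \<le> p2 \<omega>" unfolding p2 using Vpos by (auto intro!: divide_nonneg_nonneg sum_nonneg)
qed

text \<open>The weights of \<open>p2\<close> form a probability vector, so isotropy gives
  \<open>p2\<close> mean exactly one, and their trace costs only \<open>C\<close> in the tail
  bounds.\<close>

lemma p2_weights: "0 \<le> 1 / (u - l i)\<^sup>2 / V" "1 / (u - l i)\<^sup>2 / V \<le> 1" "(\<Sum>i\<in>UNIV. 1 / (u - l i)\<^sup>2 / V) = 1"
proof -
  show "0 \<le> 1 / (u - l i)\<^sup>2 / V" using step_facts(6) by simp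
  have "1 / (u - l i)\<^sup>2 \<le> V" unfolding V by (rule member_le_sum) auto
  then show "1 / (u - l i)\<^sup>2 / V \<le> 1" by (simp only: divide_le_eq_1_pos[OF step_facts(6)])
  show "(\<Sum>i\<in>UNIV. 1 / (u - l i)\<^sup>2 / V) = 1"
    unfolding sum_divide_distrib[symmetric] V[symmetric] using step_facts(6) by simp
qed

lemma integrable_p2: "integrable M p2" and expectation_p2: "expectation p2 = 1"
proof -
  show "integrable M p2" unfolding step_facts(8)[abs_def] by simp
  show "expectation p2 = 1"
    unfolding step_facts(8)[abs_def] using e p2_weights(3)
    by (simp add: expectation_inner_square orthonormal_family_def)
qed

lemma measurable_p [measurable]: "p1 \<in> borel_measurable M" "p2 \<in> borel_measurable M"
  unfolding p1 p2 by measurable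

text \<open>Both tails use \<open>weighted_tail\<close> with \<open>h = D\<close>. The budget is
  \<open>C * \<phi> + D * \<phi> + \<alpha> / 2 \<le> \<alpha>\<close> for \<open>p1\<close> and
  \<open>C + D + 2 * D \<le> 4 * D\<close> for \<open>p2\<close>, since the choice of
  \<open>\<phi>\<close> turns \<open>\<phi> * p2 \<le> \<alpha>\<close> into
  \<open>p2 \<le> 4 * D\<close>. Each contributes half of the bound.\<close>

lemma prob_irregular_le:
  "prob {\<omega> \<in> space M. \<not> (p1 \<omega> \<le> \<alpha> \<and> \<phi> * p2 \<omega> \<le> \<alpha>)} \<le> C * D powr (- \<eta>) / (\<eta> * D)"
proof -
  have \<phi>D: "\<phi> * D = \<alpha> / 4" using D by (simp add: \<phi>)
  have sums: "C * (\<Sum>i\<in>UNIV. 1 / (u - l i)) \<le> \<alpha> / 32"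
    using mult_left_mono[OF step_facts(2), of C] step_facts(5) C by linarith
  have P1: "prob {\<omega> \<in> space M. \<alpha> < p1 \<omega>} \<le> \<phi> * C * D powr (- \<eta>) / (\<eta> * (\<alpha> / 2))"
    unfolding step_facts(7)
  proof (rule weighted_tail[OF e])
    show "0 \<le> 1 / (u - l i)" for i using step_facts(1)[of i] by (simp add: less_imp_le)
    show "C * (\<Sum>i\<in>UNIV. 1 / (u - l i)) + D * \<phi> + \<alpha> / 2 \<le> \<alpha>"
      using sums \<phi>D \<alpha> by (simp add: mult.commute[of D])
  qed (use step_facts(3) D \<alpha> in auto)
  have P2: "prob {\<omega> \<in> space M. 4 * D < p2 \<omega>} \<le> 1 * C * D powr (- \<eta>) / (\<eta> * (2 * D))"
    unfolding step_facts(8)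
  proof (rule weighted_tail[OF e])
    show "C * (\<Sum>i\<in>UNIV. 1 / (u - l i)\<^sup>2 / V) + D * 1 + 2 * D \<le> 4 * D"
      using p2_weights(3) D by simp
  qed (use p2_weights D in auto)
  have eq: "\<phi> * p2 \<omega> \<le> \<alpha> \<longleftrightarrow> p2 \<omega> \<le> 4 * D" for \<omega>
    using D \<alpha> by (simp add: \<phi> divide_le_eq mult_ac)
  have "prob {\<omega> \<in> space M. \<not> (p1 \<omega> \<le> \<alpha> \<and> \<phi> * p2 \<omega> \<le> \<alpha>)}
      \<le> prob ({\<omega> \<in> space M. \<alpha> < p1 \<omega>} \<union> {\<omega> \<in> space M. 4 * D < p2 \<omega>})"
    unfolding eq by (intro finite_measure_mono) auto
  also have "\<dots> \<le> prob {\<omega> \<in> space M. \<alpha> < p1 \<omega>} + prob {\<omega> \<in> space M. 4 * D < p2 \<omega>}"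
    by (intro measure_Un_le) auto
  also have "\<dots> \<le> \<phi> * C * D powr (- \<eta>) / (\<eta> * (\<alpha> / 2)) + 1 * C * D powr (- \<eta>) / (\<eta> * (2 * D))"
    using P1 P2 by linarith
  also have "\<dots> = C * D powr (- \<eta>) / (\<eta> * D)"
    using \<alpha> D \<eta> by (simp add: \<phi> field_simps)
  finally show ?thesis .
qed

text \<open>Off the irregular event the increment is at most a multiple of \<open>p2\<close>, whose
  mean is one. On it the increment is cut at \<open>D\<close>: the part below costs \<open>D\<close>
  times the small probability of the event, and the part above is controlled by a power tail of the
  increment.\<close>

lemma expectation_soft_edge_add_le_aux:
  "expectation (\<lambda>\<omega>. soft_edge \<phi> (diag_in e l + outer_self (X \<omega>)))
    \<le> u + 1 / (1 - 2 * \<alpha>) + C * D powr (- \<eta>) / \<eta> + 8 * 8 powr \<eta> * C / \<eta> * D powr (- \<eta>) / \<eta>"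
proof -
  define Z where "Z \<omega> = soft_edge \<phi> (diag_in e l + outer_self (X \<omega>)) - u" for \<omega>
  have int: "integrable M (\<lambda>\<omega>. soft_edge \<phi> (diag_in e l + outer_self (X \<omega>)))"
    using integrable_soft_edge[OF step_facts(4), of "diag_in e l" 1] by simp
  then have intZ: "integrable M Z" unfolding Z_def[abs_def] by simp
  then have [measurable]: "Z \<in> borel_measurable M" by simp
  define Bad where "Bad = {\<omega> \<in> space M. \<not> (p1 \<omega> \<le> \<alpha> \<and> \<phi> * p2 \<omega> \<le> \<alpha>)}"
  have [measurable]: "Bad \<in> events" unfolding Bad_def by measurable
  \<comment> \<open>An increment above \<open>t\<close> forces \<open>q1\<close> or
    \<open>q2\<close>, the normalised forms for the shift \<open>t\<close>, to be large; the
    deterministic criterion is split evenly between them.\<close>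
  have tailZ: "prob {\<omega> \<in> space M. t < Z \<omega>} \<le> (8 * 8 powr \<eta> * C / \<eta>) * t powr (- 1 - \<eta>)" if t: "t > D" for t
  proof -
    have tpos: "t > 0" using t D by simp
    define d where "d i = u - l i" for i
    have d: "d i > 0" for i using step_facts(1) by (simp add: d_def)
    have dt: "d i + t > 0" "d i * (d i + t) > 0" for i using d tpos by (auto simp: add_pos_pos)
    define W where "W = (\<Sum>i\<in>UNIV. 1 / (d i * (d i + t)))"
    have W: "W > 0" unfolding W_def using dt by (intro sum_pos) auto
    define q1 where "q1 \<omega> = (\<Sum>i\<in>UNIV. 1 / (d i + t) * (e i \<bullet> X \<omega>)\<^sup>2)" for \<omega>
    define q2 where "q2 \<omega> = (\<Sum>i\<in>UNIV. (1 / (d i * (d i + t)) / W) * (e i \<bullet> X \<omega>)\<^sup>2)" for \<omega>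
    have [measurable]: "q1 \<in> borel_measurable M" "q2 \<in> borel_measurable M"
      unfolding q1_def[abs_def] q2_def[abs_def] by measurable
    have "Z \<omega> \<le> t" if "q1 \<omega> \<le> 1 / 2" "q2 \<omega> \<le> t / 2" for \<omega>
    proof -
      have "u + t \<in> edge_set \<phi> (diag_in e l + outer_self (X \<omega>))"
      proof (rule edge_set_add_outer_self[OF e u tpos])
        show "(\<Sum>i\<in>UNIV. (e i \<bullet> X \<omega>)\<^sup>2 / (u - l i + t)) < 1"
          using that(1) by (simp add: q1_def d_def)
        show "W = (\<Sum>i\<in>UNIV. 1 / ((u - l i) * (u - l i + t)))" by (simp add: W_def d_def)
        have "q2 \<omega> / t \<le> 1 / 2" using that(2) tpos by (simp add: divide_le_eq)
        moreover have "(\<Sum>i\<in>UNIV. (e i \<bullet> X \<omega>)\<^sup>2 / ((u - l i) * (u - l i + t))) / W = q2 \<omega>"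
          by (simp add: q2_def d_def sum_divide_distrib mult_ac)
        ultimately show "(\<Sum>i\<in>UNIV. (e i \<bullet> X \<omega>)\<^sup>2 / (u - l i + t))
            + (\<Sum>i\<in>UNIV. (e i \<bullet> X \<omega>)\<^sup>2 / ((u - l i) * (u - l i + t))) / W / t \<le> 1"
          using that(1) by (simp only: q1_def d_def times_divide_eq_left mult_1)
      qed
      from soft_edge_le[OF this] show ?thesis by (simp add: Z_def)
    qed
    then have "prob {\<omega> \<in> space M. t < Z \<omega>}
        \<le> prob ({\<omega> \<in> space M. 1 / 2 < q1 \<omega>} \<union> {\<omega> \<in> space M. t / 2 < q2 \<omega>})"
      by (intro finite_measure_mono) (auto simp: not_le[symmetric])
    also have "\<dots> \<le> prob {\<omega> \<in> space M. 1 / 2 < q1 \<omega>} + prob {\<omega> \<in> space M. t / 2 < q2 \<omega>}"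
      by (intro measure_Un_le) auto
    \<comment> \<open>The weights are at most \<open>1 / t\<close>; with \<open>h = t / 8\<close>
      and margin \<open>1 / 4\<close>, the term \<open>C * \<phi>\<close> fits into the rest of
      \<open>1 / 2\<close>.\<close>
    also have "prob {\<omega> \<in> space M. 1 / 2 < q1 \<omega>} \<le> (1 / t) * C * (t / 8) powr (- \<eta>) / (\<eta> * (1 / 4))"
      unfolding q1_def
    proof (rule weighted_tail[OF e])
      show "0 \<le> 1 / (d i + t)" "1 / (d i + t) \<le> 1 / t" for i
        using d[of i] tpos by (auto intro!: divide_left_mono simp: less_imp_le)
      have "(\<Sum>i\<in>UNIV. 1 / (d i + t)) \<le> (\<Sum>i\<in>UNIV. 1 / (u - l i))"
        using d tpos dt by (intro sum_mono divide_left_mono) (auto simp: d_def)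
      then have "(\<Sum>i\<in>UNIV. 1 / (d i + t)) \<le> \<phi>" using step_facts(2) by linarith
      then have "C * (\<Sum>i\<in>UNIV. 1 / (d i + t)) \<le> C * \<phi>" using C by (intro mult_left_mono) auto
      then show "C * (\<Sum>i\<in>UNIV. 1 / (d i + t)) + t / 8 * (1 / t) + 1 / 4 \<le> 1 / 2"
        using step_facts(5) \<alpha> tpos by simp
    qed (use tpos in auto)
    \<comment> \<open>The weights sum to one, so the budget is
      \<open>C + t / 8 + t / 4 \<le> t / 2\<close>; here \<open>8 * C \<le> D < t\<close>
      enters.\<close>
    also have "prob {\<omega> \<in> space M. t / 2 < q2 \<omega>} \<le> 1 * C * (t / 8) powr (- \<eta>) / (\<eta> * (t / 4))"
      unfolding q2_def
    proof (rule weighted_tail[OF e])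
      show "0 \<le> 1 / (d i * (d i + t)) / W" for i
        using dt[of i] W by (intro divide_nonneg_pos) auto
      have "1 / (d i * (d i + t)) \<le> W" for i
        unfolding W_def using dt by (intro member_le_sum) (auto simp: less_imp_le)
      then show "1 / (d i * (d i + t)) / W \<le> 1" for i by (simp only: divide_le_eq_1_pos[OF W])
      have "(\<Sum>i\<in>UNIV. 1 / (d i * (d i + t)) / W) = 1"
        unfolding sum_divide_distrib[symmetric] W_def[symmetric] using W by simp
      then show "C * (\<Sum>i\<in>UNIV. 1 / (d i * (d i + t)) / W) + t / 8 * 1 + t / 4 \<le> t / 2"
        using D t by simp
    qed (use tpos in auto)
    also have "(1 / t) * C * (t / 8) powr (- \<eta>) / (\<eta> * (1 / 4)) + 1 * C * (t / 8) powr (- \<eta>) / (\<eta> * (t / 4))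
        = (8 * 8 powr \<eta> * C / \<eta>) * (t powr (- \<eta>) / t)"
      using tpos \<eta> by (simp add: powr_divide powr_minus field_simps)
    also have "t powr (- \<eta>) / t = t powr (- 1 - \<eta>)"
      using tpos by (simp add: powr_diff powr_minus field_simps)
    finally show ?thesis by simp
  qed
  have tail: "expectation (\<lambda>\<omega>. max 0 (Z \<omega> - D)) \<le> (8 * 8 powr \<eta> * C / \<eta>) * D powr (- \<eta>) / \<eta>"
    using C \<eta> D tailZ by (intro expectation_excess_le[OF intZ]) auto
  have pointwise: "Z \<omega> \<le> p2 \<omega> / (1 - 2 * \<alpha>) + D * indicator Bad \<omega> + max 0 (Z \<omega> - D)"
    if \<omega>: "\<omega> \<in> space M" for \<omega>
  proof (cases "\<omega> \<in> Bad")
    case True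
    have "0 \<le> p2 \<omega> / (1 - 2 * \<alpha>)" using step_facts(9) \<alpha> by simp
    then show ?thesis using True by simp
  next
    case False
    then have "p1 \<omega> \<le> \<alpha>" "\<phi> * p2 \<omega> \<le> \<alpha>" using \<omega> by (auto simp: Bad_def)
    then have "u + p2 \<omega> / (1 - 2 * \<alpha>) \<in> edge_set \<phi> (diag_in e l + outer_self (X \<omega>))"
      using \<alpha> by (intro edge_set_add_outer_self_regular[OF e u _ _ V]) (auto simp: p1 p2)
    from soft_edge_le[OF this] have "Z \<omega> \<le> p2 \<omega> / (1 - 2 * \<alpha>)" by (simp add: Z_def)
    then show ?thesis using False by simp
  qed
  have "expectation Z \<le> expectation (\<lambda>\<omega>. p2 \<omega> / (1 - 2 * \<alpha>) + D * indicator Bad \<omega> + max 0 (Z \<omega> - D))"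
    using intZ integrable_p2 pointwise by (intro integral_mono) (auto simp: less_top[symmetric])
  also have "\<dots> = 1 / (1 - 2 * \<alpha>) + D * prob Bad + expectation (\<lambda>\<omega>. max 0 (Z \<omega> - D))"
    using intZ integrable_p2 expectation_p2 by (simp add: less_top[symmetric])
  also have "D * prob Bad \<le> D * (C * D powr (- \<eta>) / (\<eta> * D))"
    using prob_irregular_le D unfolding Bad_def by (intro mult_left_mono) auto
  also have "\<dots> = C * D powr (- \<eta>) / \<eta>" using D by simp
  finally have "expectation Z \<le> 1 / (1 - 2 * \<alpha>) + C * D powr (- \<eta>) / \<eta> + (8 * 8 powr \<eta> * C / \<eta>) * D powr (- \<eta>) / \<eta>"
    using tail by linarith
  moreover have "expectation Z = expectation (\<lambda>\<omega>. soft_edge \<phi> (diag_in e l + outer_self (X \<omega>))) - u"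
    unfolding Z_def[abs_def] using int by (simp add: prob_space)
  ultimately show ?thesis by linarith
qed

text \<open>Subtracting a positive semidefinite matrix never raises the edge, so large increments do
  no harm. What is lost on the irregular event is the gain, at most \<open>p2\<close>, and this is
  dominated by \<open>D\<close> plus the excess of \<open>p2\<close> over \<open>D\<close>.\<close>

lemma expectation_soft_edge_diff_le_aux:
  "expectation (\<lambda>\<omega>. soft_edge \<phi> (diag_in e l - outer_self (X \<omega>)))
    \<le> u - (1 - 2 * \<alpha>) + C * D powr (- \<eta>) / \<eta> + 2 powr \<eta> * C * D powr (- \<eta>) / \<eta>"
proof -
  define Z where "Z \<omega> = soft_edge \<phi> (diag_in e l - outer_self (X \<omega>)) - u" for \<omega>
  have int: "integrable M (\<lambda>\<omega>. soft_edge \<phi> (diag_in e l - outer_self (X \<omega>)))"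
    using integrable_soft_edge[OF step_facts(4), of "diag_in e l" "- 1"] by simp
  then have intZ: "integrable M Z" unfolding Z_def[abs_def] by simp
  define Bad where "Bad = {\<omega> \<in> space M. \<not> (p1 \<omega> \<le> \<alpha> \<and> \<phi> * p2 \<omega> \<le> \<alpha>)}"
  have [measurable]: "Bad \<in> events" unfolding Bad_def by measurable
  \<comment> \<open>Taken with \<open>h = D / 2\<close>; the remaining half of \<open>D\<close>
    covers the trace term \<open>C\<close>.\<close>
  have "expectation (\<lambda>\<omega>. max 0 (p2 \<omega> - D)) \<le> 1 * C * (D / 2) powr (- \<eta>) / \<eta>"
    unfolding step_facts(8) using p2_weights D by (intro weighted_excess[OF e]) auto
  also have "(D / 2) powr (- \<eta>) = 2 powr \<eta> * D powr (- \<eta>)"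
    using D by (simp add: powr_divide powr_minus field_simps)
  finally have tail: "expectation (\<lambda>\<omega>. max 0 (p2 \<omega> - D)) \<le> 2 powr \<eta> * C * D powr (- \<eta>) / \<eta>"
    by (simp add: mult_ac)
  have pointwise: "Z \<omega> \<le> - (1 - 2 * \<alpha>) * p2 \<omega> + D * indicator Bad \<omega> + max 0 (p2 \<omega> - D)"
    if \<omega>: "\<omega> \<in> space M" for \<omega>
  proof (cases "\<omega> \<in> Bad")
    case True
    have "u + 0 \<in> edge_set \<phi> (diag_in e l - outer_self (X \<omega>))"
      by (rule edge_set_shift[OF u])
        (simp_all add: transpose_diff matrix_vector_mult_diff_rdistrib inner_diff_right inner_outer_self)
    from soft_edge_le[OF this] have "Z \<omega> \<le> 0" by (simp add: Z_def)
    also have "0 \<le> - (1 - 2 * \<alpha>) * p2 \<omega> + p2 \<omega>" using step_facts(9)[of \<omega>] \<alpha> by (simp add: algebra_simps)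
    also have "\<dots> \<le> - (1 - 2 * \<alpha>) * p2 \<omega> + D + max 0 (p2 \<omega> - D)" by simp
    finally show ?thesis using True by simp
  next
    case False
    then have "p1 \<omega> \<le> \<alpha>" "\<phi> * p2 \<omega> \<le> \<alpha>" using \<omega> by (auto simp: Bad_def)
    then have "u - (1 - 2 * \<alpha>) * p2 \<omega> \<in> edge_set \<phi> (diag_in e l - outer_self (X \<omega>))"
      using \<alpha> by (intro edge_set_diff_outer_self_regular[OF e u _ _ V]) (auto simp: p1 p2)
    from soft_edge_le[OF this] have "Z \<omega> \<le> - (1 - 2 * \<alpha>) * p2 \<omega>" unfolding Z_def by linarith
    then show ?thesis using False by simp
  qed
  have "expectation Z \<le> expectation (\<lambda>\<omega>. - (1 - 2 * \<alpha>) * p2 \<omega> + D * indicator Bad \<omega> + max 0 (p2 \<omega> - D))"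
    using intZ integrable_p2 pointwise by (intro integral_mono) (auto simp: less_top[symmetric])
  also have "\<dots> = - (1 - 2 * \<alpha>) + D * prob Bad + expectation (\<lambda>\<omega>. max 0 (p2 \<omega> - D))"
    using integrable_p2 expectation_p2 by (simp add: less_top[symmetric])
  also have "D * prob Bad \<le> D * (C * D powr (- \<eta>) / (\<eta> * D))"
    using prob_irregular_le D unfolding Bad_def by (intro mult_left_mono) auto
  also have "\<dots> = C * D powr (- \<eta>) / \<eta>" using D by simp
  finally have "expectation Z \<le> - (1 - 2 * \<alpha>) + C * D powr (- \<eta>) / \<eta> + 2 powr \<eta> * C * D powr (- \<eta>) / \<eta>"
    using tail by linarith
  moreover have "expectation Z = expectation (\<lambda>\<omega>. soft_edge \<phi> (diag_in e l - outer_self (X \<omega>))) - u"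
    unfolding Z_def[abs_def] using int by (simp add: prob_space)
  ultimately show ?thesis by linarith
qed

end

text \<open>The bounds hold for every point of the edge set, so its infimum need not be attained.\<close>

lemma
  fixes A :: "real^'n^'n"
  assumes A: "transpose A = A" and \<alpha>: "0 < \<alpha>" "\<alpha> \<le> 1 / 4" and D: "D > 0" "8 * C \<le> D"
    and \<phi>: "\<phi> = \<alpha> / (4 * D)"
  shows expectation_soft_edge_add_le: "expectation (\<lambda>\<omega>. soft_edge \<phi> (A + outer_self (X \<omega>)))
      \<le> soft_edge \<phi> A + (1 / (1 - 2 * \<alpha>) + C * D powr (- \<eta>) / \<eta> + 8 * 8 powr \<eta> * C / \<eta> * D powr (- \<eta>) / \<eta>)"
      (is "?E1 \<le> _ + ?c1")
    and expectation_soft_edge_diff_le: "expectation (\<lambda>\<omega>. soft_edge \<phi> (A - outer_self (X \<omega>)))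
      \<le> soft_edge \<phi> A + (- (1 - 2 * \<alpha>) + C * D powr (- \<eta>) / \<eta> + 2 powr \<eta> * C * D powr (- \<eta>) / \<eta>)"
      (is "?E2 \<le> _ + ?c2")
proof -
  have ne: "edge_set \<phi> A \<noteq> {}" using A \<alpha> D by (intro edge_set_nonempty) (auto simp: \<phi>)
  obtain e l where e: "orthonormal_family e" and Ae: "A = diag_in e l"
    using symmetric_eq_diag_in[OF A] by blast
  have "?E1 - ?c1 \<le> u" "?E2 - ?c2 \<le> u" if "u \<in> edge_set \<phi> A" for u
    using expectation_soft_edge_add_le_aux[OF e that[unfolded Ae] \<alpha> D \<phi> refl refl refl]
      expectation_soft_edge_diff_le_aux[OF e that[unfolded Ae] \<alpha> D \<phi> refl refl refl]
    by (simp_all add: Ae)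
  then have "?E1 - ?c1 \<le> soft_edge \<phi> A" "?E2 - ?c2 \<le> soft_edge \<phi> A"
    unfolding soft_edge_def[of _ A] using ne by (auto intro!: cInf_greatest)
  then show "?E1 \<le> soft_edge \<phi> A + ?c1" "?E2 \<le> soft_edge \<phi> A + ?c2" by linarith+
qed

end

subsection \<open>Summation over independent vectors\<close>

lemma borel_measurable_outer_self [measurable]: "outer_self \<in> borel_measurable borel"
  using continuous_on_outer_self by (rule borel_measurable_continuous_onI)

lemma transpose_zero: "transpose (0 :: real^'n^'m) = 0"
  by (vector transpose_def)

context prob_space
begin

text \<open>The two sides are functions of disjoint blocks of the independent family.\<close>

lemma indep_var_sum_outer_self:
  fixes X :: "nat \<Rightarrow> 'a \<Rightarrow> real^'n"
  assumes indep: "indep_vars (\<lambda>_. borel) X {1..N}" and "Suc k \<le> N"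
  shows "indep_var borel (\<lambda>\<omega>. \<Sum>i=1..k. outer_self (X i \<omega>)) borel (\<lambda>\<omega>. outer_self (X (Suc k) \<omega>))"
proof -
  have "indep_var
    borel ((\<lambda>f. \<Sum>i=1..k. outer_self (f i)) \<circ> (\<lambda>\<omega>. restrict (\<lambda>i. X i \<omega>) {1..k}))
    borel ((\<lambda>f. outer_self (f (Suc k))) \<circ> (\<lambda>\<omega>. restrict (\<lambda>i. X i \<omega>) {Suc k}))"
    using assms(2) by (intro indep_var_compose[OF indep_var_restrict[OF indep]]
        borel_measurable_sum measurable_compose[OF _ borel_measurable_outer_self]) auto
  also have "((\<lambda>f. \<Sum>i=1..k. outer_self (f i)) \<circ> (\<lambda>\<omega>. restrict (\<lambda>i. X i \<omega>) {1..k}))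
      = (\<lambda>\<omega>. \<Sum>i=1..k. outer_self (X i \<omega>))"
    by (auto intro!: sum.cong)
  also have "((\<lambda>f. outer_self (f (Suc k))) \<circ> (\<lambda>\<omega>. restrict (\<lambda>i. X i \<omega>) {Suc k}))
      = (\<lambda>\<omega>. outer_self (X (Suc k) \<omega>))" by auto
  finally show ?thesis .
qed

text \<open>Induction on \<open>k\<close>, adding one vector at a time: conditionally on the partial
  sum, the step bound holds with the same \<open>c\<close>, so it survives averaging over the law of
  the partial sum. Identical distribution is not assumed, because \<open>c\<close> is uniform in
  \<open>i\<close>.\<close>

lemma expectation_sum_outer_self_le:
  fixes X :: "nat \<Rightarrow> 'a \<Rightarrow> real^'n" and F :: "real^'n^'n \<Rightarrow> real"
  assumes indep: "indep_vars (\<lambda>_. borel) X {1..N}"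
    and lip: "\<And>A A'. transpose A = A \<Longrightarrow> transpose A' = A' \<Longrightarrow> \<bar>F A - F A'\<bar> \<le> norm (A - A')"
    and intX: "\<And>i. i \<in> {1..N} \<Longrightarrow> integrable M (\<lambda>\<omega>. outer_self (X i \<omega>))"
    and step: "\<And>i A. i \<in> {1..N} \<Longrightarrow> transpose A = A \<Longrightarrow>
      expectation (\<lambda>\<omega>. F (A + outer_self (X i \<omega>))) \<le> F A + c"
    and "k \<le> N"
  shows "integrable M (\<lambda>\<omega>. F (\<Sum>i=1..k. outer_self (X i \<omega>))) \<and>
    expectation (\<lambda>\<omega>. F (\<Sum>i=1..k. outer_self (X i \<omega>))) \<le> F 0 + real k * c"
  using assms(5)
proof (induction k)
  case 0
  then show ?case by (simp add: prob_space)
next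
  case (Suc k)
  \<comment> \<open>\<open>F\<close> is controlled only on symmetric matrices, whereas the laws live
    on all matrices. Composing with the symmetric part gives a function continuous everywhere that
    agrees with \<open>F\<close> on the values taken.\<close>
  define symm :: "real^'n^'n \<Rightarrow> real^'n^'n" where "symm A = (1 / 2) *\<^sub>R (A + transpose A)" for A
  have symm: "transpose (symm A) = symm A" for A
    by (simp add: symm_def transpose_add transpose_scalar add.commute)
  have symm_id: "symm A = A" if "transpose A = A" for A
    using that by (simp add: symm_def flip: scaleR_2)
  have F_cont: "continuous_on {A. transpose A = A} F"
    using lip by (rule continuous_on_symmetric_if_lipschitz)
  have symm_cont: "continuous_on S symm" for S
    unfolding symm_def[abs_def] transpose_def by (intro continuous_intros)
  define G where "G p = F (symm (fst p) + symm (snd p))" for p :: "(real^'n^'n) \<times> (real^'n^'n)"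
  have "continuous_on UNIV G"
    unfolding G_def[abs_def] by (intro continuous_on_compose2[OF F_cont]
        continuous_on_compose2[OF symm_cont] continuous_intros)
      (auto simp: transpose_add symm)
  then have G_meas: "G \<in> borel_measurable (borel \<Otimes>\<^sub>M borel)"
    unfolding borel_prod by (rule borel_measurable_continuous_onI)
  define R where "R \<omega> = outer_self (X (Suc k) \<omega>)" for \<omega>
  have symR: "transpose (R \<omega>) = R \<omega>" for \<omega> by (simp add: R_def)
  define S where "S \<omega> = (\<Sum>i=1..k. outer_self (X i \<omega>))" for \<omega>
  have symS: "transpose (S \<omega>) = S \<omega>" for \<omega> by (simp add: S_def transpose_sum)
  have iv: "indep_var borel S borel R"
    using indep_var_sum_outer_self[OF indep Suc.prems] by (simp add: S_def[abs_def] R_def[abs_def])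
  then have [measurable]: "S \<in> borel_measurable M" "R \<in> borel_measurable M"
    by (blast dest: indep_var_rv1 indep_var_rv2)+
  have SucS: "(\<Sum>i=1..Suc k. outer_self (X i \<omega>)) = S \<omega> + R \<omega>" for \<omega>
    by (simp add: S_def R_def)
  have FG: "F (\<Sum>i=1..Suc k. outer_self (X i \<omega>)) = G (S \<omega>, R \<omega>)" for \<omega>
    by (simp only: SucS G_def fst_conv snd_conv symm_id[OF symS] symm_id[OF symR])
  have intS: "integrable M S"
    unfolding S_def[abs_def] using intX Suc.prems by (intro Bochner_Integration.integrable_sum) auto
  have int_bound: "integrable M (\<lambda>\<omega>. \<bar>F 0\<bar> + norm (S \<omega> + R \<omega>))"
    using intS intX[of "Suc k"] Suc.prems unfolding R_def by (intro Bochner_Integration.integrable_add integrable_norm) auto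
  have intG: "integrable M (\<lambda>\<omega>. G (S \<omega>, R \<omega>))"
  proof (rule Bochner_Integration.integrable_bound[OF int_bound], goal_cases)
    case 1
    show ?case using G_meas by measurable
  next
    case 2
    show ?case
    proof (intro AE_I2)
      fix \<omega>
      have "\<bar>F (S \<omega> + R \<omega>) - F 0\<bar> \<le> norm (S \<omega> + R \<omega> - 0)"
        by (intro lip) (auto simp: transpose_add symS symR transpose_zero)
      then show "norm (G (S \<omega>, R \<omega>)) \<le> norm (\<bar>F 0\<bar> + norm (S \<omega> + R \<omega>))"
        unfolding G_def by (simp add: symm_id[OF symS] symm_id[OF symR])
    qed
  qed
  interpret pS: prob_space "distr M borel S" by (rule prob_space_distr) simp
  interpret pX: prob_space "distr M borel R" by (rule prob_space_distr) simp
  interpret pp: pair_prob_space "distr M borel S" "distr M borel R" ..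
  \<comment> \<open>Independence makes the joint law a product, so the new vector can be integrated
    first with the partial sum frozen.\<close>
  have joint: "distr M borel S \<Otimes>\<^sub>M distr M borel R = distr M (borel \<Otimes>\<^sub>M borel) (\<lambda>\<omega>. (S \<omega>, R \<omega>))"
    using iv by (simp add: indep_var_distribution_eq)
  have intG': "integrable (distr M borel S \<Otimes>\<^sub>M distr M borel R) G"
    unfolding joint using intG G_meas by (subst integrable_distr_eq) auto
  have IH: "integrable M (\<lambda>\<omega>. F (S \<omega>))" "expectation (\<lambda>\<omega>. F (S \<omega>)) \<le> F 0 + real k * c"
    using Suc by (simp_all add: S_def)
  have Fsymm_meas: "(\<lambda>A. F (symm A)) \<in> borel_measurable borel"
    using symm by (intro borel_measurable_continuous_onI continuous_on_compose2[OF F_cont symm_cont]) auto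
  have intFS: "integrable (distr M borel S) (\<lambda>A. F (symm A))"
    using IH(1) Fsymm_meas by (subst integrable_distr_eq) (auto simp: symm_id[OF symS] symm_id[OF symR])
  have "expectation (\<lambda>\<omega>. G (S \<omega>, R \<omega>)) = integral\<^sup>L (distr M borel S \<Otimes>\<^sub>M distr M borel R) G"
    unfolding joint using G_meas by (subst integral_distr) auto
  also have "\<dots> = (\<integral>A. (\<integral>x. G (A, x) \<partial>distr M borel R) \<partial>distr M borel S)"
    by (rule pp.integral_fst'[OF intG', symmetric])
  also have "\<dots> \<le> (\<integral>A. F (symm A) + c \<partial>distr M borel S)"
  proof (rule integral_mono)
    show "integrable (distr M borel S) (\<lambda>A. \<integral>x. G (A, x) \<partial>distr M borel R)"
      by (rule pp.integrable_fst'[OF intG'])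
    show "integrable (distr M borel S) (\<lambda>A. F (symm A) + c)" using intFS by simp
    fix A
    have "(\<lambda>x. G (A, x)) \<in> borel_measurable borel"
      using G_meas by measurable
    then have "(\<integral>x. G (A, x) \<partial>distr M borel R) = expectation (\<lambda>\<omega>. F (symm A + R \<omega>))"
      by (subst integral_distr) (auto simp: G_def symm_id[OF symR])
    also have "\<dots> \<le> F (symm A) + c" unfolding R_def using Suc.prems symm by (intro step) auto
    finally show "(\<integral>x. G (A, x) \<partial>distr M borel R) \<le> F (symm A) + c" .
  qed
  also have "\<dots> = expectation (\<lambda>\<omega>. F (S \<omega>)) + c"
    using intFS Fsymm_meas pS.prob_space by (simp add: integral_distr symm_id[OF symS] symm_id[OF symR])
  also have "\<dots> \<le> F 0 + real (Suc k) * c" using IH(2) by (simp add: algebra_simps)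
  finally show ?case using intG unfolding FG by blast
qed

section \<open>Mean deviation of one marginal\<close>

text \<open>Second moments add because independence and centering remove the cross terms; the bound
  \<open>B\<close> secures integrability.\<close>

lemma expectation_square_sum_centered:
  fixes W :: "nat \<Rightarrow> 'a \<Rightarrow> real"
  assumes indep: "indep_vars (\<lambda>_. borel) W {1..N}"
    and bound: "\<And>i \<omega>. i \<in> {1..N} \<Longrightarrow> \<bar>W i \<omega>\<bar> \<le> B"
    and mean: "\<And>i. i \<in> {1..N} \<Longrightarrow> expectation (W i) = 0"
    and second: "\<And>i. i \<in> {1..N} \<Longrightarrow> expectation (\<lambda>\<omega>. (W i \<omega>)\<^sup>2) \<le> \<sigma>"
    and "k \<le> N"
  shows "integrable M (\<lambda>\<omega>. (\<Sum>i=1..k. W i \<omega>)\<^sup>2) \<and> expectation (\<lambda>\<omega>. (\<Sum>i=1..k. W i \<omega>)\<^sup>2) \<le> real k * \<sigma>"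
  using assms(5)
proof (induction k)
  case (Suc k)
  define S where "S \<omega> = (\<Sum>i=1..k. W i \<omega>)" for \<omega>
  have meas: "W i \<in> borel_measurable M" if "i \<in> {1..N}" for i
    using indep that by (auto simp: indep_vars_def)
  have W: "W (Suc k) \<in> borel_measurable M" "integrable M (W (Suc k))" "integrable M (\<lambda>\<omega>. (W (Suc k) \<omega>)\<^sup>2)"
  proof -
    show m: "W (Suc k) \<in> borel_measurable M" using meas Suc.prems by simp
    show "integrable M (W (Suc k))"
      using bound[of "Suc k"] Suc.prems m by (intro integrable_const_bound[of _ B]) auto
    have "(W (Suc k) \<omega>)\<^sup>2 \<le> B\<^sup>2" for \<omega>
      using bound[of "Suc k" \<omega>] Suc.prems by (simp add: abs_le_square_iff[symmetric])
    then show "integrable M (\<lambda>\<omega>. (W (Suc k) \<omega>)\<^sup>2)"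
      using m by (intro integrable_const_bound[of _ "B\<^sup>2"]) auto
  qed
  have intS: "integrable M S"
    unfolding S_def[abs_def]
    using bound meas Suc.prems by (intro Bochner_Integration.integrable_sum integrable_const_bound[of _ B]) auto
  have IH: "integrable M (\<lambda>\<omega>. (S \<omega>)\<^sup>2)" "expectation (\<lambda>\<omega>. (S \<omega>)\<^sup>2) \<le> real k * \<sigma>"
    using Suc by (simp_all add: S_def)
  have "indep_vars (\<lambda>_. borel) W (insert (Suc k) {1..k})"
    using Suc.prems by (intro indep_vars_subset[OF indep]) auto
  then have iv: "indep_var borel (W (Suc k)) borel S"
    unfolding S_def[abs_def] by (intro indep_vars_sum) auto
  have int_prod: "integrable M (\<lambda>\<omega>. W (Suc k) \<omega> * S \<omega>)"
    by (rule indep_var_integrable[OF iv W(2) intS])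
  have prod: "expectation (\<lambda>\<omega>. W (Suc k) \<omega> * S \<omega>) = 0"
    using indep_var_lebesgue_integral[OF iv W(2) intS] mean[of "Suc k"] Suc.prems by simp
  have eq: "(\<Sum>i=1..Suc k. W i \<omega>)\<^sup>2 = (S \<omega>)\<^sup>2 + 2 * (W (Suc k) \<omega> * S \<omega>) + (W (Suc k) \<omega>)\<^sup>2" for \<omega>
    by (simp add: S_def power2_sum)
  have "expectation (\<lambda>\<omega>. (S \<omega>)\<^sup>2 + 2 * (W (Suc k) \<omega> * S \<omega>) + (W (Suc k) \<omega>)\<^sup>2)
      = expectation (\<lambda>\<omega>. (S \<omega>)\<^sup>2) + expectation (\<lambda>\<omega>. (W (Suc k) \<omega>)\<^sup>2)"
    using IH(1) int_prod W(3) by (simp add: prod)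
  also have "\<dots> \<le> real (Suc k) * \<sigma>"
    using IH(2) second[of "Suc k"] Suc.prems by (simp add: algebra_simps)
  finally show ?case unfolding eq using IH(1) int_prod W(3) by simp
qed simp

text \<open>Squared marginals may have infinite variance, so they are cut at \<open>D\<close>. The
  truncated part has second moment at most \<open>D\<close> times its mean, hence at most
  \<open>D\<close>. The remainder is counted twice: as a random term, and through the centering of
  the truncated part.\<close>

lemma weak_law_isotropic_tail:
  fixes X :: "nat \<Rightarrow> 'a \<Rightarrow> real^'n" and e :: "'n \<Rightarrow> real^'n"
  assumes N: "N > 0" and indep: "indep_vars (\<lambda>_. borel) X {1..N}"
    and iso: "\<And>i. i \<in> {1..N} \<Longrightarrow> isotropic_tail M (X i) C \<eta>"
    and e: "orthonormal_family e" and D: "D > 0" "C \<le> D" and c: "c > 0"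
  shows "expectation (\<lambda>\<omega>. \<bar>(\<Sum>i=1..N. (e j \<bullet> X i \<omega>)\<^sup>2) / real N - 1\<bar>)
    \<le> 2 * (C * D powr (- \<eta>) / \<eta>) + D / (2 * real N * c) + c / 2"
proof -
  define Y where "Y i \<omega> = (e j \<bullet> X i \<omega>)\<^sup>2" for i \<omega>
  define R where "R i \<omega> = max 0 (Y i \<omega> - D)" for i \<omega>
  define T where "T i \<omega> = min (Y i \<omega>) D" for i \<omega>
  define W where "W i \<omega> = T i \<omega> - expectation (T i)" for i \<omega>
  have Y: "integrable M (Y i)" "expectation (Y i) = 1" if "i \<in> {1..N}" for i
  proof -
    interpret isotropic_tail M "X i" C \<eta> using iso that by blast
    show "integrable M (Y i)" "expectation (Y i) = 1"
      using e by (simp_all add: Y_def[abs_def] expectation_inner_square orthonormal_family_def)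
  qed
  have R: "integrable M (R i)" "expectation (R i) \<le> C * D powr (- \<eta>) / \<eta>" if "i \<in> {1..N}" for i
  proof -
    interpret isotropic_tail M "X i" C \<eta> using iso that by blast
    show "integrable M (R i)" unfolding R_def[abs_def] using Y[OF that] by (intro integrable_max) auto
    show "expectation (R i) \<le> C * D powr (- \<eta>) / \<eta>"
      using projection_excess[OF e, of D "{j}"] D by (simp add: R_def[abs_def] Y_def)
  qed
  have YTR: "Y i \<omega> = T i \<omega> + R i \<omega>" for i \<omega> by (simp add: T_def R_def)
  have T0: "0 \<le> T i \<omega>" "T i \<omega> \<le> D" for i \<omega> using D by (simp_all add: T_def Y_def)
  have T: "integrable M (T i)" "expectation (T i) = 1 - expectation (R i)" "0 \<le> expectation (T i)" "expectation (T i) \<le> D"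
      "expectation (T i) \<le> 1" if "i \<in> {1..N}" for i
  proof -
    have eq: "T i = (\<lambda>\<omega>. Y i \<omega> - R i \<omega>)" using YTR by (simp add: fun_eq_iff)
    show int: "integrable M (T i)" unfolding eq using Y R that by simp
    show "expectation (T i) = 1 - expectation (R i)" unfolding eq using Y R that by simp
    show "0 \<le> expectation (T i)" using T0 by (intro Bochner_Integration.integral_nonneg) auto
    have "expectation (T i) \<le> expectation (\<lambda>_. D)" using T0 int by (intro integral_mono) auto
    then show "expectation (T i) \<le> D" by (simp add: prob_space)
    have "expectation (T i) \<le> expectation (Y i)" using int Y that by (intro integral_mono) (auto simp: T_def)
    then show "expectation (T i) \<le> 1" using Y that by simp
  qed
  have W_indep: "indep_vars (\<lambda>_. borel) W {1..N}"
    unfolding W_def[abs_def] T_def Y_def by (rule indep_vars_compose2[OF indep]) measurable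
  have W_bound: "\<bar>W i \<omega>\<bar> \<le> D" if "i \<in> {1..N}" for i \<omega>
    using T0[of i \<omega>] T[OF that] by (simp add: W_def abs_le_iff)
  have W_mean: "expectation (W i) = 0" if "i \<in> {1..N}" for i
    using T[OF that] by (simp add: W_def[abs_def] prob_space)
  have W_second: "expectation (\<lambda>\<omega>. (W i \<omega>)\<^sup>2) \<le> D" if "i \<in> {1..N}" for i
  proof -
    have sq: "(T i \<omega>)\<^sup>2 \<le> D * T i \<omega>" for \<omega>
      using T0[of i \<omega>] by (simp add: power2_eq_square mult_right_mono)
    have int: "integrable M (\<lambda>\<omega>. (T i \<omega>)\<^sup>2)"
      using T[OF that] sq T0 D
      by (intro Bochner_Integration.integrable_bound[of M "\<lambda>\<omega>. D * T i \<omega>" "\<lambda>\<omega>. (T i \<omega>)\<^sup>2"]) auto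
    have "expectation (\<lambda>\<omega>. (W i \<omega>)\<^sup>2) = expectation (\<lambda>\<omega>. (T i \<omega>)\<^sup>2) - (expectation (T i))\<^sup>2"
      unfolding W_def using T[OF that] int by (intro variance_eq) auto
    also have "\<dots> \<le> expectation (\<lambda>\<omega>. (T i \<omega>)\<^sup>2)" by simp
    also have "\<dots> \<le> expectation (\<lambda>\<omega>. D * T i \<omega>)"
      using int sq T(1)[OF that] by (intro integral_mono) auto
    also have "\<dots> = D * expectation (T i)" by simp
    also have "\<dots> \<le> D" using T[OF that] D by simp
    finally show ?thesis .
  qed
  let ?S = "\<lambda>\<omega>. \<Sum>i=1..N. W i \<omega>"
  have S: "integrable M (\<lambda>\<omega>. (?S \<omega>)\<^sup>2)" "expectation (\<lambda>\<omega>. (?S \<omega>)\<^sup>2) \<le> real N * D"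
    using expectation_square_sum_centered[OF W_indep W_bound W_mean W_second order_refl] by auto
  let ?g = "\<lambda>\<omega>. (?S \<omega>)\<^sup>2 / (2 * (real N)\<^sup>2 * c) + c / 2 + (\<Sum>i=1..N. R i \<omega>) / real N + (\<Sum>i=1..N. expectation (R i)) / real N"
  have "\<bar>(\<Sum>i=1..N. Y i \<omega>) / real N - 1\<bar> \<le> ?g \<omega>" for \<omega>
  proof -
    have "(\<Sum>i=1..N. Y i \<omega>) = (\<Sum>i=1..N. W i \<omega> + R i \<omega> + 1 - expectation (R i))"
      using T(2) by (intro sum.cong) (auto simp: W_def YTR)
    also have "\<dots> = ?S \<omega> + (\<Sum>i=1..N. R i \<omega>) + real N - (\<Sum>i=1..N. expectation (R i))"
      by (simp add: sum.distrib sum_subtractf)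
    finally have eq: "(\<Sum>i=1..N. Y i \<omega>) / real N - 1
        = ?S \<omega> / real N + (\<Sum>i=1..N. R i \<omega>) / real N - (\<Sum>i=1..N. expectation (R i)) / real N"
      using N by (simp add: add_divide_distrib diff_divide_distrib)
    have nn: "0 \<le> (\<Sum>i=1..N. R i \<omega>) / real N" "0 \<le> (\<Sum>i=1..N. expectation (R i)) / real N"
      by (auto intro!: divide_nonneg_nonneg sum_nonneg Bochner_Integration.integral_nonneg simp: R_def)
    have "\<bar>?S \<omega> / real N\<bar> \<le> (?S \<omega> / real N)\<^sup>2 / (2 * c) + c / 2"
    proof -
      have "\<bar>z\<bar> \<le> z\<^sup>2 / (2 * c) + c / 2" for z :: real
      proof -
        \<comment> \<open>This square inequality passes from the second moment to the mean absolute
          value; \<open>c\<close> is a free balance between its two terms.\<close>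
        have "0 \<le> (\<bar>z\<bar> - c)\<^sup>2" by simp
        then have "\<bar>z\<bar> * (2 * c) \<le> z\<^sup>2 + c\<^sup>2" by (simp add: power2_diff)
        then have "\<bar>z\<bar> \<le> (z\<^sup>2 + c\<^sup>2) / (2 * c)" using c by (simp only: pos_le_divide_eq)
        also have "\<dots> = z\<^sup>2 / (2 * c) + c / 2" using c by (simp add: add_divide_distrib power2_eq_square)
        finally show ?thesis .
      qed
      then show ?thesis by blast
    qed
    also have "(?S \<omega> / real N)\<^sup>2 / (2 * c) = (?S \<omega>)\<^sup>2 / (2 * (real N)\<^sup>2 * c)"
      by (simp add: power_divide mult_ac)
    finally show ?thesis unfolding eq using nn by linarith
  qed
  moreover have sums: "integrable M (\<lambda>\<omega>. \<Sum>i=1..N. R i \<omega>)" "integrable M (\<lambda>\<omega>. \<Sum>i=1..N. Y i \<omega>)"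
      "expectation (\<lambda>\<omega>. \<Sum>i=1..N. R i \<omega>) = (\<Sum>i=1..N. expectation (R i))"
    using R(1) Y(1) by (auto intro!: Bochner_Integration.integrable_sum Bochner_Integration.integral_sum)
  ultimately have "expectation (\<lambda>\<omega>. \<bar>(\<Sum>i=1..N. Y i \<omega>) / real N - 1\<bar>) \<le> expectation ?g"
    using S(1) sums by (intro integral_mono) auto
  also have "\<dots> = expectation (\<lambda>\<omega>. (?S \<omega>)\<^sup>2) / (2 * (real N)\<^sup>2 * c) + c / 2 + 2 * (\<Sum>i=1..N. expectation (R i)) / real N"
    using S(1) sums by (simp add: prob_space del: Bochner_Integration.integral_sum)
  also have "expectation (\<lambda>\<omega>. (?S \<omega>)\<^sup>2) / (2 * (real N)\<^sup>2 * c) \<le> real N * D / (2 * (real N)\<^sup>2 * c)"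
    using S(2) c by (intro divide_right_mono) auto
  also have "\<dots> = D / (2 * real N * c)" using N by (simp add: power2_eq_square)
  also have "2 * (\<Sum>i=1..N. expectation (R i)) / real N \<le> 2 * (C * D powr (- \<eta>) / \<eta>)"
  proof -
    have "(\<Sum>i=1..N. expectation (R i)) \<le> real N * (C * D powr (- \<eta>) / \<eta>)"
      using sum_bounded_above[of "{1..N}" "\<lambda>i. expectation (R i)" "C * D powr (- \<eta>) / \<eta>"] R(2) by simp
    then have "(\<Sum>i=1..N. expectation (R i)) / real N \<le> C * D powr (- \<eta>) / \<eta>"
      using N by (simp only: pos_divide_le_eq of_nat_0_less_iff mult.commute[of "real N"])
    then show ?thesis by simp
  qed
  finally show ?thesis by (simp add: Y_def)
qed

end

section \<open>Operator norm and numerical constants\<close>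

text \<open>Each eigenvalue is the quadratic form at a unit eigenvector, and in eigencoordinates the
  matrix scales each coordinate by its eigenvalue.\<close>

lemma spectral_norm_le:
  fixes S :: "real^'n^'n"
  assumes S: "transpose S = S" and le: "\<And>y. norm y = 1 \<Longrightarrow> \<bar>y \<bullet> (S *v y)\<bar> \<le> m"
  shows "spectral_norm S \<le> m"
  unfolding spectral_norm_def
proof (rule onorm_le)
  fix x
  obtain e l where e: "orthonormal_family e" and Se: "S = diag_in e l"
    using symmetric_eq_diag_in[OF S] by blast
  have l: "\<bar>l i\<bar> \<le> m" for i
  proof -
    have "e i \<bullet> e i = 1" using e by (simp add: orthonormal_family_def)
    then show ?thesis
      using le[of "e i"] orthonormal_inner_diag_in[OF e, of i l "e i"] by (simp add: Se norm_eq_1)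
  qed
  then have m: "0 \<le> m" by (meson abs_ge_zero order_trans)
  have "(norm (S *v x))\<^sup>2 = (\<Sum>i\<in>UNIV. (l i)\<^sup>2 * (e i \<bullet> x)\<^sup>2)"
    unfolding power2_norm_eq_inner orthonormal_parseval[OF e, of "S *v x" "S *v x"]
    by (simp add: Se orthonormal_inner_diag_in[OF e] power2_eq_square mult_ac)
  also have "\<dots> \<le> (\<Sum>i\<in>UNIV. m\<^sup>2 * (e i \<bullet> x)\<^sup>2)"
    using l m by (intro sum_mono mult_right_mono) (auto simp: abs_le_square_iff[symmetric])
  also have "\<dots> = (m * norm x)\<^sup>2"
    unfolding power_mult_distrib power2_norm_eq_inner orthonormal_parseval[OF e, of x x]
    by (simp add: sum_distrib_left power2_eq_square)
  finally show "norm (S *v x) \<le> m * norm x" using m by (auto intro: power2_le_imp_le mult_nonneg_nonneg)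
qed

text \<open>The two demands on the truncation level: the first admits the one-step bounds, the
  second fits all tail remainders into a fixed fraction of \<open>\<epsilon>\<close>. Both reduce to
  \<open>96 \<le> a * b\<close>, which follows from \<open>lower\<close> and the bound of
  \<open>exp 1\<close> by 3.\<close>

lemma main_constant_bounds:
  fixes C \<eta> \<epsilon> D :: real
  assumes C: "C > 0" and \<eta>: "\<eta> > 0" and \<epsilon>: "0 < \<epsilon>" "\<epsilon> < 1"
    and lower: "1 \<le> exp 1 * (C * (1 + 1 / \<eta>))"
    and D: "D = (48 * C) powr (2 + 2 / \<eta>) * (6 + 6 / \<eta>) powr (1 + 4 / \<eta>) * \<epsilon> powr (- 2 / \<eta>) / 2"
  shows "8 * C \<le> D" "9 * 8 powr \<eta> * C * (1 + 1 / \<eta>)\<^sup>2 * D powr (- \<eta>) \<le> \<epsilon> / 16"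
proof -
  define r a b where "r = 1 + 1 / \<eta>" and "a = 48 * C" and "b = 6 * r"
  have r: "r > 1" using \<eta> by (simp add: r_def)
  have b: "b \<ge> 6" "b > 0" using r by (auto simp: b_def)
  have a: "a > 0" using C by (simp add: a_def)
  have "exp 1 * (C * r) \<le> 3 * (C * r)" using C r by (intro mult_right_mono exp_le) auto
  then have "1 \<le> 3 * (C * r)" using lower unfolding r_def by linarith
  then have ab: "96 \<le> a * b" by (simp add: a_def b_def)
  have b_eq: "6 + 6 / \<eta> = b" by (simp add: b_def r_def algebra_simps)
  have D': "D = a powr (2 + 2 / \<eta>) * b powr (1 + 4 / \<eta>) * \<epsilon> powr (- 2 / \<eta>) / 2"
    by (simp add: D a_def b_eq)
  have \<epsilon>1: "1 \<le> \<epsilon> powr (- 2 / \<eta>)"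
  proof -
    have "\<epsilon> powr 0 \<le> \<epsilon> powr (- 2 / \<eta>)" using \<epsilon> \<eta> by (intro powr_mono') (auto simp: divide_nonpos_pos)
    then show ?thesis using \<epsilon> by simp
  qed
  have Dpos: "D > 0" unfolding D' using a b \<epsilon> by simp
  \<comment> \<open>Apart from \<open>a * (a * b)\<close>, only powers of numbers that are at least
    one remain.\<close>
  have "a powr (2 + 2 / \<eta>) * b powr (1 + 4 / \<eta>) = a * (a * b) * ((a * b) powr (2 / \<eta>) * b powr (2 / \<eta>))"
  proof -
    have "a powr (2 + 2 / \<eta>) = a * a * a powr (2 / \<eta>)"
      using a by (simp add: powr_add power2_eq_square)
    moreover have "b powr (1 + 4 / \<eta>) = b * (b powr (2 / \<eta>) * b powr (2 / \<eta>))"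
    proof -
      have "b powr (1 + 4 / \<eta>) = b powr (1 + (2 / \<eta> + 2 / \<eta>))" by simp
      also have "\<dots> = b powr 1 * (b powr (2 / \<eta>) * b powr (2 / \<eta>))" by (simp only: powr_add)
      finally show ?thesis using b(2) by simp
    qed
    ultimately show ?thesis using a b by (simp add: powr_mult)
  qed
  also have "\<dots> \<ge> a * 96 * (1 * 1)"
    using a ab b \<eta> by (intro mult_mono ge_one_powr_ge_zero) auto
  finally have "a * 96 \<le> a powr (2 + 2 / \<eta>) * b powr (1 + 4 / \<eta>)" by simp
  then have "a * 96 * 1 \<le> a powr (2 + 2 / \<eta>) * b powr (1 + 4 / \<eta>) * \<epsilon> powr (- 2 / \<eta>)"
    by (rule mult_mono[OF _ \<epsilon>1]) auto
  then show "8 * C \<le> D" using C by (simp add: D' a_def)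
  have D\<eta>: "D powr \<eta> = a powr (2 * \<eta> + 2) * b powr (\<eta> + 4) * \<epsilon> powr (- 2) / 2 powr \<eta>"
  proof -
    have "D powr \<eta> = (a powr (2 + 2 / \<eta>)) powr \<eta> * (b powr (1 + 4 / \<eta>)) powr \<eta> * (\<epsilon> powr (- 2 / \<eta>)) powr \<eta> / 2 powr \<eta>"
      unfolding D' using a b \<epsilon> by (simp add: powr_divide powr_mult)
    then show ?thesis using \<eta> by (simp add: powr_powr distrib_right)
  qed
  \<comment> \<open>The second claim with denominators cleared: \<open>144 = 9 * 16\<close>, and
    \<open>16 powr \<eta>\<close> joins \<open>8 powr \<eta>\<close> with the
    \<open>2 powr \<eta>\<close> caused by the factor \<open>1 / 2\<close> in
    \<open>D\<close>.\<close>
  have main: "144 * 16 powr \<eta> * C * r\<^sup>2 \<le> a powr (2 * \<eta> + 2) * b powr (\<eta> + 4)"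
  proof -
    have "r powr \<eta> \<le> 3"
      using one_plus_inverse_powr_le[OF \<eta>] exp_le unfolding r_def by linarith
    then have "1 / (6 powr \<eta> * 3) \<le> 1 / b powr \<eta>"
      using r b by (intro divide_left_mono) (auto simp: b_def powr_mult)
    then have b1: "1 / (6 powr \<eta> * 3) \<le> b powr (- \<eta>)" by (simp only: powr_minus_divide)
    \<comment> \<open>Here \<open>1536\<close> is \<open>96\<^sup>2 / 6\<close>, with
      \<open>96\<close> the lower bound on \<open>a * b\<close> and \<open>6\<close> the factor in
      \<open>b = 6 * r\<close>.\<close>
    have "144 * 16 powr \<eta> * C * r\<^sup>2 \<le> 144 * (96 powr (2 * \<eta>) / 6 powr \<eta>) * C * r\<^sup>2"
    proof -
      have "(1536 :: real) powr \<eta> = (9216 / 6) powr \<eta>" by simp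
      also have "\<dots> = 9216 powr \<eta> / 6 powr \<eta>" by (rule powr_divide)
      also have "(9216 :: real) powr \<eta> = 96 powr (2 * \<eta>)" using powr_powr[of 96 2 \<eta>] by simp
      finally have "(96 :: real) powr (2 * \<eta>) / 6 powr \<eta> = 1536 powr \<eta>" by simp
      moreover have "(16 :: real) powr \<eta> \<le> 1536 powr \<eta>" using \<eta> by (intro powr_mono2) auto
      ultimately show ?thesis using C by (intro mult_right_mono mult_left_mono) auto
    qed
    also have "\<dots> \<le> a * (96 * 96 powr (2 * \<eta>)) * (b\<^sup>2 * 6 * (1 / (6 powr \<eta> * 3)))"
      using C r by (simp add: a_def b_def power2_eq_square field_simps)
    also have "\<dots> \<le> a * (a * b * (a * b) powr (2 * \<eta>)) * (b\<^sup>2 * b * b powr (- \<eta>))"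
      using a b ab b1 \<eta> by (intro mult_mono powr_mono2) auto
    also have "\<dots> = a powr (2 * \<eta> + 2) * b powr (\<eta> + 4)"
    proof -
      have "b powr (\<eta> + 4) = b powr (2 * \<eta> + 4 + - \<eta>)" by simp
      also have "\<dots> = b powr (2 * \<eta>) * b ^ 4 * b powr (- \<eta>)"
        using b by (simp only: powr_add powr_numeral)
      finally show ?thesis using a b by (simp add: powr_mult powr_add power_numeral_reduce)
    qed
    finally show ?thesis .
  qed
  \<comment> \<open>\<open>D powr \<eta>\<close> carries \<open>\<epsilon> powr (- 2)\<close>, which
    exceeds \<open>\<epsilon> powr (- 1)\<close> because \<open>\<epsilon> < 1\<close>.\<close>
  have "144 * 16 powr \<eta> * C * r\<^sup>2 * \<epsilon> powr (- 1) \<le> a powr (2 * \<eta> + 2) * b powr (\<eta> + 4) * \<epsilon> powr (- 2)"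
    using \<epsilon> C by (intro mult_mono[OF main] powr_mono') auto
  also have "\<dots> = D powr \<eta> * 2 powr \<eta>" by (simp add: D\<eta>)
  finally have "144 * 8 powr \<eta> * C * r\<^sup>2 * \<epsilon> powr (- 1) \<le> D powr \<eta>"
  proof -
    assume *: "144 * 16 powr \<eta> * C * r\<^sup>2 * \<epsilon> powr (- 1) \<le> D powr \<eta> * 2 powr \<eta>"
    have "(16 :: real) powr \<eta> = 8 powr \<eta> * 2 powr \<eta>" by (simp flip: powr_mult)
    with * have "(144 * 8 powr \<eta> * C * r\<^sup>2 * \<epsilon> powr (- 1)) * 2 powr \<eta> \<le> D powr \<eta> * 2 powr \<eta>"
      by (simp add: mult_ac)
    then show ?thesis by (rule mult_right_le_imp_le) simp
  qed
  then show "9 * 8 powr \<eta> * C * (1 + 1 / \<eta>)\<^sup>2 * D powr (- \<eta>) \<le> \<epsilon> / 16"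
    using \<epsilon> Dpos unfolding r_def[symmetric] by (simp add: powr_minus field_simps)
qed

section \<open>Assembly of the expectation bound\<close>

theorem theorem1p1:
  fixes M :: "'a measure" and X :: "nat \<Rightarrow> 'a \<Rightarrow> real ^ 'n"
    and N :: nat and C \<eta> \<epsilon> :: real
  assumes "prob_space M"
    and "N > 0"
    and "prob_space.indep_vars M (\<lambda>_. borel) X {1..N}"
    and "\<And>i. i \<in> {1..N} \<Longrightarrow> isotropic M (X i)"
    and "C > 0" and "\<eta> > 0"
    and "\<And>i (P :: real ^ 'n ^ 'n) t. i \<in> {1..N} \<Longrightarrow> orthogonal_projection P \<Longrightarrow>
           t > C * real (rank P) \<Longrightarrow>
           \<P>(\<omega> in M. (norm (P *v X i \<omega>))\<^sup>2 > t) \<le> C * t powr (- 1 - \<eta>)"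
    and "0 < \<epsilon>" and "\<epsilon> < 1"
    and "real N \<ge> C_main C \<eta> * \<epsilon> powr (- 2 - 2 / \<eta>) * real CARD('n)"
  shows "prob_space.expectation M (\<lambda>\<omega>. spectral_norm
           ((1 / real N) *\<^sub>R (\<Sum>i = 1..N. outer_self (X i \<omega>)) - mat 1)) \<le> \<epsilon>"
proof -
  interpret prob_space M by fact
  \<comment> \<open>Chosen so that the assumption on \<open>N\<close> reads
    \<open>1024 * D / \<epsilon>\<^sup>2 * real CARD('n) \<le> real N\<close>.\<close>
  define D where "D = (48 * C) powr (2 + 2 / \<eta>) * (6 + 6 / \<eta>) powr (1 + 4 / \<eta>) * \<epsilon> powr (- 2 / \<eta>) / 2"
  define K where "K = C * D powr (- \<eta>) / \<eta>"
  define \<alpha> \<phi> where "\<alpha> = \<epsilon> / 16" and "\<phi> = \<alpha> / (4 * D)"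
  have C: "C > 0" and \<eta>: "\<eta> > 0" and \<epsilon>: "0 < \<epsilon>" "\<epsilon> < 1" and N: "N > 0" by fact+
  have iso: "isotropic_tail M (X i) C \<eta>" if "i \<in> {1..N}" for i
    using assms(4,7)[OF that] C \<eta> by unfold_locales
  have "1 \<le> exp 1 * (C * (1 + 1 / \<eta>))"
    using N by (intro isotropic_tail.one_le_tail_constant[OF iso[of 1]]) auto
  from main_constant_bounds[OF C \<eta> \<epsilon> this D_def]
  have DC: "8 * C \<le> D" and tail: "9 * 8 powr \<eta> * C * (1 + 1 / \<eta>)\<^sup>2 * D powr (- \<eta>) \<le> \<epsilon> / 16" .
  have D: "D > 0" using DC C by linarith
  have \<alpha>: "0 < \<alpha>" "\<alpha> \<le> 1 / 4" using \<epsilon> by (auto simp: \<alpha>_def)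
  have \<phi>: "\<phi> > 0" using \<alpha> D by (simp add: \<phi>_def)

  have "\<epsilon> powr (- 2 - 2 / \<eta>) = \<epsilon> powr (- 2 / \<eta>) / \<epsilon>\<^sup>2"
    using \<epsilon> by (simp add: powr_diff powr_minus divide_inverse mult.commute)
  then have "C_main C \<eta> * \<epsilon> powr (- 2 - 2 / \<eta>) = 1024 * D / \<epsilon>\<^sup>2"
    by (simp add: C_main_def D_def)
  then have N_ge: "1024 * D / \<epsilon>\<^sup>2 * real CARD('n) \<le> real N" using assms(10) by simp
  have "1024 * D / \<epsilon>\<^sup>2 * 1 \<le> 1024 * D / \<epsilon>\<^sup>2 * real CARD('n)"
    using D by (intro mult_left_mono) auto
  then have N_ge': "1024 * D / \<epsilon>\<^sup>2 \<le> real N" using N_ge by linarith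
  \<comment> \<open>Since \<open>1 / \<phi> = 64 * D / \<epsilon>\<close>, the factor
    \<open>1024\<close> leaves one sixteenth of \<open>\<epsilon>\<close>.\<close>
  have base: "real CARD('n) / \<phi> / real N \<le> \<epsilon> / 16"
  proof -
    have "1024 * D * real CARD('n) \<le> real N * \<epsilon>\<^sup>2"
      using N_ge \<epsilon> by (simp add: field_simps)
    then show ?thesis
      using \<epsilon> D N by (simp add: \<phi>_def \<alpha>_def field_simps power2_eq_square)
  qed
  have DN: "D / (2 * real N * (\<epsilon> / 16)) \<le> \<epsilon> / 128"
  proof -
    have "1024 * D \<le> real N * \<epsilon>\<^sup>2" using N_ge' \<epsilon> by (simp add: field_simps)
    then show ?thesis using \<epsilon> N by (simp add: field_simps power2_eq_square)
  qed

  define r where "r = 1 + 1 / \<eta>"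
  \<comment> \<open>A common majorant of the tail remainders, as \<open>1 / \<eta>\<close> and its
    square are both at most \<open>r\<^sup>2\<close>.\<close>
  define B where "B = C * D powr (- \<eta>) * r\<^sup>2"
  have B0: "0 \<le> B" using C by (simp add: B_def)
  have rr: "1 / \<eta> \<le> r\<^sup>2" "1 / \<eta> / \<eta> \<le> r\<^sup>2"
    using \<eta> by (auto simp: r_def power2_eq_square field_simps)
  have KB: "K \<le> B" "K / \<eta> \<le> B"
    using mult_left_mono[OF rr(1), of "C * D powr (- \<eta>)"] mult_left_mono[OF rr(2), of "C * D powr (- \<eta>)"] C
    by (simp_all add: K_def B_def)
  have p8: "1 \<le> (8 :: real) powr \<eta>" "(2 :: real) powr \<eta> \<le> 8 powr \<eta>"
    using \<eta> by (auto intro: ge_one_powr_ge_zero powr_mono2)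
  have B\<epsilon>: "9 * (8 powr \<eta> * B) \<le> \<epsilon> / 16"
    using tail by (simp add: B_def r_def mult_ac)
  have B8: "B \<le> 8 powr \<eta> * B" using mult_right_mono[OF p8(1) B0] by simp
  have c1: "K + 8 * 8 powr \<eta> * C / \<eta> * D powr (- \<eta>) / \<eta> \<le> \<epsilon> / 16"
  proof -
    have "8 * 8 powr \<eta> * C / \<eta> * D powr (- \<eta>) / \<eta> = 8 * (8 powr \<eta> * (K / \<eta>))" by (simp add: K_def)
    also have "\<dots> \<le> 8 * (8 powr \<eta> * B)" by (intro mult_left_mono KB(2)) auto
    finally show ?thesis using KB(1) B8 B\<epsilon> by linarith
  qed
  have c2: "K + 2 powr \<eta> * C * D powr (- \<eta>) / \<eta> \<le> \<epsilon> / 16"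
  proof -
    have "2 powr \<eta> * C * D powr (- \<eta>) / \<eta> = 2 powr \<eta> * K" by (simp add: K_def)
    also have "\<dots> \<le> 8 powr \<eta> * B" using KB(1) p8(2) B0 by (intro mult_mono') (auto simp: K_def C \<eta> less_imp_le)
    finally show ?thesis using KB(1) B8 B0 B\<epsilon> by linarith
  qed
  have K\<epsilon>: "9 * K \<le> \<epsilon> / 16" using KB(1) B8 B\<epsilon> by linarith
  have a1: "1 / (1 - 2 * \<alpha>) \<le> 1 + 4 * \<alpha>"
  proof -
    have "1 \<le> (1 + 4 * \<alpha>) * (1 - 2 * \<alpha>)"
      using mult_left_mono[OF \<alpha>(2), of \<alpha>] \<alpha> by (simp add: algebra_simps)
    then show ?thesis using \<alpha> by (simp add: divide_le_eq)
  qed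

  define S where "S \<omega> = (\<Sum>i = 1..N. outer_self (X i \<omega>))" for \<omega>
  have symS: "transpose (S \<omega>) = S \<omega>" for \<omega> by (simp add: S_def transpose_sum)
  have intX: "integrable M (\<lambda>\<omega>. outer_self (X i \<omega>))" if "i \<in> {1..N}" for i
    using assms(4)[OF that] by (simp add: isotropic_def has_bochner_integral_iff)
  have edge0: "soft_edge \<phi> (0 :: real^'n^'n) \<le> real CARD('n) / \<phi>"
    by (rule soft_edge_le[OF edge_set_zero[OF \<phi>]])
  define U where "U \<omega> = soft_edge \<phi> (S \<omega>)" for \<omega>
  define L where "L \<omega> = soft_edge \<phi> (- S \<omega>)" for \<omega>
  have "integrable M (\<lambda>\<omega>. soft_edge \<phi> (\<Sum>i = 1..N. outer_self (X i \<omega>))) \<and>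
    expectation (\<lambda>\<omega>. soft_edge \<phi> (\<Sum>i = 1..N. outer_self (X i \<omega>)))
      \<le> soft_edge \<phi> (0 :: real^'n^'n) + real N * (1 + 4 * \<alpha> + \<epsilon> / 16)"
  proof (rule expectation_sum_outer_self_le[where F = "soft_edge \<phi> :: real^'n^'n \<Rightarrow> real", OF assms(3)])
    fix A A' :: "real^'n^'n" assume "transpose A = A" "transpose A' = A'"
    then show "\<bar>soft_edge \<phi> A - soft_edge \<phi> A'\<bar> \<le> norm (A - A')" by (rule soft_edge_lipschitz[OF \<phi>])
  next
    show "integrable M (\<lambda>\<omega>. outer_self (X i \<omega>))" if "i \<in> {1..N}" for i
      using that by (rule intX)
  next
    fix i and A :: "real^'n^'n" assume i: "i \<in> {1..N}" and A: "transpose A = A"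
    show "expectation (\<lambda>\<omega>. soft_edge \<phi> (A + outer_self (X i \<omega>))) \<le> soft_edge \<phi> A + (1 + 4 * \<alpha> + \<epsilon> / 16)"
      using isotropic_tail.expectation_soft_edge_add_le[OF iso[OF i] A \<alpha> D DC \<phi>_def] c1 a1
      unfolding K_def by linarith
  qed simp
  then have U: "integrable M U" "expectation U \<le> real CARD('n) / \<phi> + real N * (1 + 4 * \<alpha> + \<epsilon> / 16)"
    using edge0 by (auto simp: U_def[abs_def] S_def)
  \<comment> \<open>The edge of the negated sum tracks the smallest eigenvalue; each step lowers it
    by nearly one on average.\<close>
  have "integrable M (\<lambda>\<omega>. soft_edge \<phi> (- (\<Sum>i = 1..N. outer_self (X i \<omega>)))) \<and>
    expectation (\<lambda>\<omega>. soft_edge \<phi> (- (\<Sum>i = 1..N. outer_self (X i \<omega>))))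
      \<le> soft_edge \<phi> (- (0 :: real^'n^'n)) + real N * (- (1 - 2 * \<alpha>) + \<epsilon> / 16)"
  proof (rule expectation_sum_outer_self_le[where F = "\<lambda>A :: real^'n^'n. soft_edge \<phi> (- A)", OF assms(3)])
    fix A A' :: "real^'n^'n" assume "transpose A = A" "transpose A' = A'"
    then show "\<bar>soft_edge \<phi> (- A) - soft_edge \<phi> (- A')\<bar> \<le> norm (A - A')"
      using soft_edge_lipschitz[OF \<phi>, of "- A" "- A'"] by (simp add: transpose_uminus norm_minus_commute)
  next
    show "integrable M (\<lambda>\<omega>. outer_self (X i \<omega>))" if "i \<in> {1..N}" for i
      using that by (rule intX)
  next
    fix i and A :: "real^'n^'n" assume i: "i \<in> {1..N}" and A: "transpose A = A"
    have A': "transpose (- A) = - A" using A by (simp add: transpose_uminus)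
    have "expectation (\<lambda>\<omega>. soft_edge \<phi> (- A - outer_self (X i \<omega>))) \<le> soft_edge \<phi> (- A) + (- (1 - 2 * \<alpha>) + \<epsilon> / 16)"
      using isotropic_tail.expectation_soft_edge_diff_le[OF iso[OF i] A' \<alpha> D DC \<phi>_def] c2
      unfolding K_def by linarith
    then show "expectation (\<lambda>\<omega>. soft_edge \<phi> (- (A + outer_self (X i \<omega>)))) \<le> soft_edge \<phi> (- A) + (- (1 - 2 * \<alpha>) + \<epsilon> / 16)"
      by simp
  qed simp
  then have L: "integrable M L" "expectation L \<le> real CARD('n) / \<phi> + real N * (- (1 - 2 * \<alpha>) + \<epsilon> / 16)"
    using edge0 by (auto simp: L_def[abs_def] S_def)

  define e :: "'n \<Rightarrow> real^'n" where "e = (\<lambda>i. axis i 1)"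
  have e: "orthonormal_family e" by (simp add: orthonormal_family_def e_def inner_axis_axis)
  \<comment> \<open>The deviation in one coordinate direction, the price for replacing a maximum by
    a sum below.\<close>
  define w where "w \<omega> = (\<Sum>i=1..N. (e undefined \<bullet> X i \<omega>)\<^sup>2) / real N - 1" for \<omega>
  have w: "expectation (\<lambda>\<omega>. \<bar>w \<omega>\<bar>) \<le> 2 * K + D / (2 * real N * (\<epsilon> / 16)) + \<epsilon> / 16 / 2"
    unfolding w_def K_def using D DC C \<epsilon> by (intro weak_law_isotropic_tail[OF N assms(3) iso e]) auto
  have int_w: "integrable M w"
    unfolding w_def[abs_def] using iso
    by (intro Bochner_Integration.integrable_diff integrable_divide_zero Bochner_Integration.integrable_sum
        isotropic_tail.integrable_inner_square) auto

  have quad: "y \<bullet> (S \<omega> *v y) = (\<Sum>i=1..N. (X i \<omega> \<bullet> y)\<^sup>2)" for y \<omega>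
    by (simp add: S_def matrix_sum_mult_vec inner_sum_right inner_outer_self)
  have quad': "y \<bullet> (((1 / real N) *\<^sub>R S \<omega> - mat 1) *v y) = (y \<bullet> (S \<omega> *v y)) / real N - 1"
    if "norm y = 1" for y \<omega>
    using that by (simp add: matrix_vector_mult_diff_rdistrib inner_diff_right norm_eq_1
        flip: scaleR_matrix_vector_assoc)
  have bounds: "(y \<bullet> (S \<omega> *v y)) / real N - 1 \<le> U \<omega> / real N - 1"
      "- ((y \<bullet> (S \<omega> *v y)) / real N - 1) \<le> L \<omega> / real N + 1" if "norm y = 1" for y \<omega>
  proof -
    have "y \<bullet> (S \<omega> *v y) \<le> U \<omega>"
      unfolding U_def by (rule quadratic_form_le_soft_edge[OF \<phi> symS that])
    then show "(y \<bullet> (S \<omega> *v y)) / real N - 1 \<le> U \<omega> / real N - 1"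
      by (simp add: divide_right_mono)
    have neg: "(- S \<omega>) *v y = - (S \<omega> *v y)"
      using matrix_vector_mult_diff_rdistrib[of 0 "S \<omega>" y] by simp
    have "y \<bullet> ((- S \<omega>) *v y) \<le> L \<omega>"
      unfolding L_def by (rule quadratic_form_le_soft_edge[OF \<phi> _ that]) (simp add: transpose_uminus symS)
    then have "- (y \<bullet> (S \<omega> *v y)) \<le> L \<omega>" by (simp add: neg)
    then have "- (y \<bullet> (S \<omega> *v y)) / real N \<le> L \<omega> / real N" by (rule divide_right_mono) simp
    then show "- ((y \<bullet> (S \<omega> *v y)) / real N - 1) \<le> L \<omega> / real N + 1" by simp
  qed
  \<comment> \<open>The first bracket is at least \<open>w\<close> and the second at least
    \<open>- w\<close>, so neither is below \<open>- \<bar>w\<bar>\<close>. Hence adding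
    \<open>\<bar>w\<bar>\<close> to their sum dominates each bracket, and with it the deviations of
    both signs.\<close>
  let ?f = "\<lambda>\<omega>. (U \<omega> / real N - 1) + (L \<omega> / real N + 1) + \<bar>w \<omega>\<bar>"
  have pointwise: "spectral_norm ((1 / real N) *\<^sub>R S \<omega> - mat 1) \<le> ?f \<omega>" for \<omega>
  proof (rule spectral_norm_le)
    show "transpose ((1 / real N) *\<^sub>R S \<omega> - mat 1) = (1 / real N) *\<^sub>R S \<omega> - mat 1"
      by (simp add: transpose_diff transpose_scalar symS)
    have "norm (e undefined) = 1" by (simp add: e_def norm_axis_1)
    from bounds[OF this, of \<omega>] have "w \<omega> \<le> U \<omega> / real N - 1" "- w \<omega> \<le> L \<omega> / real N + 1"
      by (simp_all add: w_def quad inner_commute)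
    then show "\<bar>y \<bullet> (((1 / real N) *\<^sub>R S \<omega> - mat 1) *v y)\<bar> \<le> ?f \<omega>" if "norm y = 1" for y
      unfolding quad'[OF that] using bounds[OF that, of \<omega>] by linarith
  qed
  have "0 \<le> spectral_norm A" for A :: "real^'n^'n"
    unfolding spectral_norm_def by (rule onorm_pos_le) (rule matrix_vector_mul_bounded_linear)
  then have nonneg: "0 \<le> ?f \<omega>" for \<omega> using pointwise order_trans by blast
  \<comment> \<open>This form of monotonicity asks integrability and nonnegativity of the majorant
    alone, so the spectral norm itself requires no integrability argument.\<close>
  have "expectation (\<lambda>\<omega>. spectral_norm ((1 / real N) *\<^sub>R S \<omega> - mat 1)) \<le> expectation ?f"
    using U(1) L(1) int_w pointwise nonneg by (intro integral_mono') auto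
  also have "\<dots> = expectation U / real N + expectation L / real N + expectation (\<lambda>\<omega>. \<bar>w \<omega>\<bar>)"
    using U(1) L(1) int_w by (simp add: prob_space)
  \<comment> \<open>The terms \<open>1\<close> and \<open>- 1\<close> of the two edges cancel. What
    remains of them is at most ten sixteenths of \<open>\<epsilon>\<close>, and the marginal adds
    less than one sixteenth.\<close>
  also have "\<dots> \<le> \<epsilon>"
  proof -
    have "expectation U / real N \<le> real CARD('n) / \<phi> / real N + (1 + 4 * \<alpha> + \<epsilon> / 16)"
      using divide_right_mono[OF U(2), of "real N"] N by (simp add: add_divide_distrib)
    moreover have "expectation L / real N \<le> real CARD('n) / \<phi> / real N + (- (1 - 2 * \<alpha>) + \<epsilon> / 16)"
      using divide_right_mono[OF L(2), of "real N"] N by (simp add: add_divide_distrib)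
    ultimately show ?thesis using base DN w K\<epsilon> \<epsilon> unfolding \<alpha>_def by linarith
  qed
  finally show ?thesis by (simp add: S_def)
qed

end
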